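(* Let $b>0$ and $\alpha\in[0,1)$. The ABR and ABC fractional derivatives satisfy a Lipschitz condition: there exists a constant $H\ge 0$ such that for all $f,h\in H^1(0,b)$, $$\left\|{}^{ABR}_{\ \ 0}D^\alpha_t(f(t)) - {}^{ABR}_{\ \ 0}D^\alpha_t(h(t))\right\| \leq H\,\|f(t)-h(t)\|$$ and $$\left\|{}^{ABC}_{\ \ 0}D^\alpha_t(f(t)) - {}^{ABC}_{\ \ 0}D^\alpha_t(h(t))\right\| \leq H\,\|f(t)-h(t)\|,$$ where $\|g(t)\|=\max_{0\le t\le b}|g(t)|$.
   Context: $E_\alpha(z)=\sum_{k=0}^\infty \frac{z^k}{\Gamma(\alpha k+1)}$ is the Mittag-Leffler function (for $\alpha=0$ it is only evaluated at $z=0$, where $E_0(0)=1$). $B:[0,1]\to\mathbb{R}$ is a fixed normalization function with $B(0)=B(1)=1$. $H^1(0,b)$ is the usual Sobolev space of real-valued functions on $(0,b)$; each $f\in H^1(0,b)$ is identified with its absolutely continuous representative on $[0,b]$. For $\alpha\in[0,1)$, $f\in H^1(0,b)$ and $t\in[0,b]$, the fractional derivatives with base point $0$ in the Caputo sense (ABC) and in the Riemann-Liouville sense (ABR) are $${}^{ABC}_{\ \ 0}D^\alpha_t(f(t)) = \frac{B(\alpha)}{1-\alpha}\int_0^t f'(x)\,E_\alpha\!\left[-\alpha\frac{(t-x)^\alpha}{1-\alpha}\right]dx,$$ $${}^{ABR}_{\ \ 0}D^\alpha_t(f(t)) = \frac{B(\alpha)}{1-\alpha}\frac{d}{dt}\int_0^t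 f(x)\,E_\alpha\!\left[-\alpha\frac{(t-x)^\alpha}{1-\alpha}\right]dx,$$ where the derivative $\frac{d}{dt}$ is one-sided at the endpoints $t=0$ and $t=b$. *)

theory Defs
  imports "HOL-Analysis.Analysis"
begin

text \<open>
  At \<open>\<alpha> = 0\<close> the sum is only meaningful for \<open>\<bar>z\<bar> < 1\<close>; below it is evaluated there at
  \<open>z = 0\<close> only, where \<open>0 ^ 0 = 1\<close> gives the value \<open>1\<close>.
\<close>

definition mittag_leffler :: "real \<Rightarrow> real \<Rightarrow> real" where
  "mittag_leffler \<alpha> z = (\<Sum>k. z ^ k / Gamma (\<alpha> * real k + 1))"

definition test_function :: "real \<Rightarrow> (real \<Rightarrow> real) \<Rightarrow> bool" where
  "test_function b \<phi> \<longleftrightarrow>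
     (\<forall>n. (deriv ^^ n) \<phi> differentiable_on UNIV) \<and> closure {x. \<phi> x \<noteq> 0} \<subseteq> {0<..<b}"

definition square_integrable :: "real \<Rightarrow> (real \<Rightarrow> real) \<Rightarrow> bool" where
  "square_integrable b f \<longleftrightarrow>
     f \<in> borel_measurable (lebesgue_on {0<..<b}) \<and> integrable (lebesgue_on {0<..<b}) (\<lambda>x. (f x)\<^sup>2)"

definition L2_weak_derivative :: "real \<Rightarrow> (real \<Rightarrow> real) \<Rightarrow> (real \<Rightarrow> real) \<Rightarrow> bool" where
  "L2_weak_derivative b f g \<longleftrightarrow> square_integrable b g \<and>
     (\<forall>\<phi>. test_function b \<phi> \<longrightarrow>
        (LINT x|lebesgue_on {0<..<b}. f x * deriv \<phi> x) = - (LINT x|lebesgue_on {0<..<b}. g x * \<phi> x))"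

definition absolutely_continuous_fun :: "real \<Rightarrow> real \<Rightarrow> (real \<Rightarrow> real) \<Rightarrow> bool" where
  "absolutely_continuous_fun a b f \<longleftrightarrow>
     (\<forall>\<epsilon>>0. \<exists>\<delta>>0. \<forall>(n::nat) u v.
        (\<forall>i<n. a \<le> u i \<and> u i \<le> v i \<and> v i \<le> b) \<and>
        (\<forall>i<n. \<forall>j<n. i \<noteq> j \<longrightarrow> {u i<..<v i} \<inter> {u j<..<v j} = {}) \<and>
        (\<Sum>i<n. v i - u i) < \<delta> \<longrightarrow>
        (\<Sum>i<n. \<bar>f (v i) - f (u i)\<bar>) < \<epsilon>)"

text \<open>
  A class in $H^1(0,b)$ is represented by its absolutely continuous representative on \<open>{0..b}\<close>;
  the values outside \<open>{0..b}\<close> are unconstrained and never used.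
\<close>

definition H1 :: "real \<Rightarrow> (real \<Rightarrow> real) set" where
  "H1 b = {f. absolutely_continuous_fun 0 b f \<and> square_integrable b f \<and>
              (\<exists>g. L2_weak_derivative b f g)}"

text \<open>Only determined almost everywhere on \<open>{0<..<b}\<close>, hence only used under integrals.\<close>

definition weak_deriv :: "real \<Rightarrow> (real \<Rightarrow> real) \<Rightarrow> real \<Rightarrow> real" where
  "weak_deriv b f = (SOME g. L2_weak_derivative b f g)"

text \<open>
  The integrals are Lebesgue integrals for the completed measure, since a weak derivative
  need not be Borel measurable. For \<open>\<alpha> = 0\<close> the argument of the kernel is \<open>0\<close>.
\<close>

definition ABC_deriv ::
    "(real \<Rightarrow> real) \<Rightarrow> real \<Rightarrow> real \<Rightarrow> (real \<Rightarrow> real) \<Rightarrow> real \<Rightarrow> real" where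
  "ABC_deriv B b \<alpha> f t = B \<alpha> / (1 - \<alpha>) *
     (LINT x|lebesgue_on {0..t}.
        weak_deriv b f x * mittag_leffler \<alpha> (- \<alpha> * ((t - x) powr \<alpha> / (1 - \<alpha>))))"

text \<open>Differentiating within \<open>{0..b}\<close> makes the derivative one-sided at \<open>0\<close> and \<open>b\<close>.\<close>

definition ABR_deriv ::
    "(real \<Rightarrow> real) \<Rightarrow> real \<Rightarrow> real \<Rightarrow> (real \<Rightarrow> real) \<Rightarrow> real \<Rightarrow> real" where
  "ABR_deriv B b \<alpha> f t = B \<alpha> / (1 - \<alpha>) *
     vector_derivative
       (\<lambda>s. LINT x|lebesgue_on {0..s}.
          f x * mittag_leffler \<alpha> (- \<alpha> * ((s - x) powr \<alpha> / (1 - \<alpha>))))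
       (at t within {0..b})"

text \<open>
  The maximum itself, not a supremum: nothing can be shown about this value
  unless the maximum is attained.
\<close>

definition max_norm :: "real \<Rightarrow> (real \<Rightarrow> real) \<Rightarrow> real" where
  "max_norm b g = (GREATEST m. m \<in> (\<lambda>t. \<bar>g t\<bar>) ` {0..b})"

end

theory Submission
  imports Defs
begin

text \<open>
  The kernel \<open>K s = E\<^sub>\<alpha> (- \<alpha> * s powr \<alpha> / (1 - \<alpha>))\<close> satisfies \<open>K s = 1 + \<integral>\<^sub>0\<^sup>s k\<close>, where \<open>k\<close> is
  integrable since it is \<open>O(s powr (\<alpha> - 1))\<close> at \<open>0\<close>. Put \<open>\<Phi> t = \<integral>\<^sub>0\<^sup>t k u * f (t - u) du\<close>. Up to the
  factor \<open>B \<alpha> / (1 - \<alpha>)\<close>, Fubini turns the ABR derivative into \<open>f t + \<Phi> t\<close> and, since \<open>f\<close> is the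
  primitive of its weak derivative, the ABC derivative into \<open>f t - f 0 * K t + \<Phi> t\<close>. Both are
  linear in \<open>f\<close>, continuous in \<open>t\<close>, so the maxima are attained, and bounded by
  \<open>2 + 2 * \<integral>\<bar>k\<bar>\<close> times the maximum of \<open>\<bar>f\<bar>\<close>.
\<close>

section \<open>Smooth step functions\<close>

text \<open>The maximum norm does not control a weak derivative, so the ABC bound is possible only
  after the derivative has been moved from \<open>f\<close> to the kernel. For \<alpha> > 0 the
  kernel is not Lipschitz at \<open>0\<close>, so everything rests on \<open>k\<close> being
  integrable rather than bounded: each estimate pairs an integrable function with a bounded one. The
  move itself is the commutation of convolution with primitives, applied to the weak derivative for
  ABC and to \<open>f\<close> itself for ABR.

  The second obstacle is that a weak derivative is known only through test functions. That
  \<open>f\<close> is its primitive has to be extracted by testing with smooth approximations of an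
  indicator, and these are built explicitly from \<open>exp (- 1 / (x * (1 - x)))\<close>.

  In the constant, \<open>f t\<close> contributes \<open>1\<close>, the convolution contributes the
  L1 norm of \<open>k\<close>, and the boundary term \<open>f 0 * K t\<close> contributes
  \<open>1\<close> plus that norm again. ABR has no boundary term and would need only half.\<close>

definition smooth_fun :: "(real \<Rightarrow> real) \<Rightarrow> bool" where
  "smooth_fun f \<longleftrightarrow> (\<forall>n. (deriv ^^ n) f differentiable_on UNIV)"

text \<open>A coinductive criterion: membership in a family closed under differentiation replaces
  any formula for the n-th derivative.\<close>

lemma smooth_funI:
  assumes "f \<in> S"
    and S: "\<And>f. f \<in> S \<Longrightarrow> \<exists>f'\<in>S. \<forall>x. (f has_real_derivative f' x) (at x)"
  shows "smooth_fun f"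
proof -
  have "(deriv ^^ n) f \<in> S" for n
  proof (induction n)
    case 0
    show ?case using assms by simp
  next
    case (Suc n)
    then obtain f' where f': "f' \<in> S" "\<And>x. ((deriv ^^ n) f has_real_derivative f' x) (at x)"
      using S by blast
    have "deriv ((deriv ^^ n) f) = f'"
      using f'(2) by (auto intro: DERIV_imp_deriv)
    then show ?case using f'(1) by simp
  qed
  moreover have "f differentiable_on UNIV" if "f \<in> S" for f
    using S[OF that] by (metis differentiable_on_def differentiable_at_withinI real_differentiable_def)
  ultimately show ?thesis
    unfolding smooth_fun_def by blast
qed

lemma smooth_fun_deriv:
  assumes "smooth_fun f"
  shows "(f has_real_derivative deriv f x) (at x)" "smooth_fun (deriv f)"
proof -
  have "(deriv ^^ 0) f differentiable_on UNIV"
    using assms unfolding smooth_fun_def by blast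
  then have "f differentiable (at x)"
    by (simp add: differentiable_on_def)
  then show "(f has_real_derivative deriv f x) (at x)"
    by (simp add: DERIV_deriv_iff_real_differentiable)
  show "smooth_fun (deriv f)"
    using assms unfolding smooth_fun_def
    by (metis comp_apply funpow_Suc_right)
qed

text \<open>A single term of the exponential series. At \<open>y = 1 / q\<close> it shows that
  \<open>exp (- 1 / q)\<close> beats every power of \<open>1 / q\<close>.\<close>

lemma power_le_fact_exp:
  fixes y :: real
  assumes "y \<ge> 0"
  shows "y ^ n \<le> fact n * exp y"
proof -
  have s: "(\<lambda>n. y ^ n /\<^sub>R fact n) sums exp y"
    by (rule exp_converges)
  have "(\<Sum>k\<in>{n}. y ^ k /\<^sub>R fact k) \<le> (\<Sum>k. y ^ k /\<^sub>R fact k)"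
    by (rule sum_le_suminf) (use assms sums_summable[OF s] in auto)
  then show ?thesis
    using sums_unique[OF s] by (simp add: field_simps)
qed

text \<open>A family containing a bump on \<open>{0..1}\<close> and closed under differentiation.\<close>

definition bump_fun :: "real poly \<Rightarrow> nat \<Rightarrow> real \<Rightarrow> real" where
  "bump_fun p m x = (if 0 < x \<and> x < 1
     then poly p x / (x * (1 - x)) ^ m * exp (- 1 / (x * (1 - x))) else 0)"

text \<open>Quadratic vanishing at the two junction points forces derivative \<open>0\<close> there,
  whatever \<open>p\<close> and \<open>m\<close> are; this is what glues the two branches of
  \<open>bump_fun\<close> smoothly.\<close>

lemma bump_fun_quadratic_bound:
  "\<exists>C. \<forall>x y. x = 0 \<or> x = 1 \<longrightarrow> \<bar>bump_fun p m y\<bar> \<le> C * (y - x)\<^sup>2"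
proof -
  have "compact ((\<lambda>x. poly p x) ` {0..1})"
    by (intro compact_continuous_image continuous_intros) auto
  then obtain D where D: "\<And>y. y \<in> {0..1} \<Longrightarrow> \<bar>poly p y\<bar> \<le> D"
    using compact_imp_bounded by (fastforce simp: bounded_iff)
  have D0: "D \<ge> 0"
    using D[of 0] by auto
  have "\<bar>bump_fun p m y\<bar> \<le> D * fact (m + 2) * (y - x)\<^sup>2" if x: "x = 0 \<or> x = 1" for x y
  proof (cases "0 < y \<and> y < 1")
    case True
    define q where "q = y * (1 - y)"
    have q: "q > 0" using True by (simp add: q_def)
    \<comment> \<open>Of the exponent, \<open>m\<close> cancels the denominator of
      \<open>bump_fun\<close> and the remaining \<open>2\<close> yields the quadratic decay.\<close>
    have "(1 / q) ^ (m + 2) \<le> fact (m + 2) * exp (1 / q)"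
      using q by (intro power_le_fact_exp) auto
    then have "exp (- 1 / q) / q ^ m \<le> fact (m + 2) * q\<^sup>2"
      using q by (simp add: exp_minus field_simps power_add power2_eq_square)
    moreover have "q \<le> \<bar>y - x\<bar>"
    proof (cases "x = 0")
      case True
      then show ?thesis using \<open>0 < y \<and> y < 1\<close> by (simp add: q_def mult_left_le)
    next
      case False
      then show ?thesis using \<open>0 < y \<and> y < 1\<close> x by (simp add: q_def mult_left_le_one_le)
    qed
    then have "q\<^sup>2 \<le> (y - x)\<^sup>2"
      using q by (metis abs_le_square_iff abs_of_pos)
    ultimately have e: "exp (- 1 / q) / q ^ m \<le> fact (m + 2) * (y - x)\<^sup>2"
      by (meson fact_ge_zero mult_left_mono order_trans)
    have "\<bar>bump_fun p m y\<bar> = \<bar>poly p y\<bar> * (exp (- 1 / q) / q ^ m)"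
      using True q by (simp add: bump_fun_def q_def abs_mult)
    also have "\<dots> \<le> D * (fact (m + 2) * (y - x)\<^sup>2)"
      using True q D0 by (intro mult_mono e D) auto
    finally show ?thesis by (simp add: mult.assoc)
  next
    case False
    then have "bump_fun p m y = 0"
      by (auto simp: bump_fun_def)
    then show ?thesis using D0 by simp
  qed
  then show ?thesis by blast
qed

lemma has_real_derivative_zeroI:
  fixes F :: "real \<Rightarrow> real"
  assumes "\<And>y. \<bar>F y\<bar> \<le> C * (y - x)\<^sup>2"
  shows "(F has_real_derivative 0) (at x)"
proof -
  have F0: "F x = 0"
    using assms[of x] by simp
  have "((\<lambda>y. F y / (y - x)) \<longlongrightarrow> 0) (at x)"
  proof (rule Lim_null_comparison)
    show "\<forall>\<^sub>F y in at x. norm (F y / (y - x)) \<le> C * \<bar>y - x\<bar>"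
    proof (rule eventually_at_topological[THEN iffD2], intro exI[of _ UNIV] conjI ballI impI)
      fix y assume "y \<noteq> x"
      then show "norm (F y / (y - x)) \<le> C * \<bar>y - x\<bar>"
        using assms[of y] by (simp add: divide_le_eq power2_eq_square mult.assoc flip: abs_mult)
    qed auto
    have "((\<lambda>y. C * \<bar>y - x\<bar>) \<longlongrightarrow> C * \<bar>x - x\<bar>) (at x)"
      by (intro tendsto_intros)
    then show "((\<lambda>y. C * \<bar>y - x\<bar>) \<longlongrightarrow> 0) (at x)"
      by simp
  qed
  then show ?thesis
    by (simp add: has_field_derivative_iff F0)
qed

lemma bump_fun_has_derivative:
  "\<exists>p' m'. \<forall>x. (bump_fun p m has_real_derivative bump_fun p' m' x) (at x)"
proof -
  define q where "q = [:0, 1, -1::real:]"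
  \<comment> \<open>The derivative of \<open>p / q ^ m * exp (- 1 / q)\<close>, brought over the
    common denominator \<open>q ^ (m + 2)\<close>.\<close>
  define p' where "p' = pderiv p * q\<^sup>2 - smult (real m) (p * pderiv q * q) + p * pderiv q"
  have pq: "poly q x = x * (1 - x)" for x
    by (simp add: q_def algebra_simps)
  have "(bump_fun p m has_real_derivative bump_fun p' (m + 2) x) (at x)" for x
  proof -
    consider "0 < x" "x < 1" | "x < 0 \<or> x > 1" | "x = 0 \<or> x = 1" by linarith
    then show "(bump_fun p m has_real_derivative bump_fun p' (m + 2) x) (at x)"
    proof cases
      case 1
      let ?g = "\<lambda>x. poly p x / poly q x ^ m * exp (- 1 / poly q x)"
      have q0: "poly q x > 0" using 1 by (simp add: pq)
      \<comment> \<open>Writing \<open>q ^ (m - 1)\<close> as \<open>q ^ m / q\<close> is harmless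
        at \<open>m = 0\<close>, where the natural subtraction truncates but the factor
        \<open>real m\<close> vanishes.\<close>
      have "real m * (poly (pderiv q) x * poly q x ^ (m - Suc 0))
          = real m * poly q x ^ m / poly q x * poly (pderiv q) x"
        using q0 by (cases m) auto
      then have d: "((\<lambda>x. poly q x ^ m) has_real_derivative
          real m * poly q x ^ m / poly q x * poly (pderiv q) x) (at x)"
        using DERIV_power[OF poly_DERIV[of q x], of m] by simp
      have "(?g has_real_derivative (poly (pderiv p) x / poly q x ^ m
          - real m * poly p x * poly (pderiv q) x / (poly q x ^ m * poly q x)
          + poly p x / poly q x ^ m * (poly (pderiv q) x / (poly q x)\<^sup>2)) * exp (- 1 / poly q x)) (at x)"
        by (rule derivative_eq_intros d poly_DERIV refl | use q0 in simp; fail)+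
          (use q0 in \<open>simp add: field_simps power2_eq_square\<close>)
      also have "(poly (pderiv p) x / poly q x ^ m
          - real m * poly p x * poly (pderiv q) x / (poly q x ^ m * poly q x)
          + poly p x / poly q x ^ m * (poly (pderiv q) x / (poly q x)\<^sup>2)) * exp (- 1 / poly q x)
        = bump_fun p' (m + 2) x"
        using 1 q0 by (simp add: bump_fun_def p'_def field_simps power_add power2_eq_square flip: pq)
      finally have "(?g has_real_derivative bump_fun p' (m + 2) x) (at x)" .
      then show ?thesis
      proof (rule has_field_derivative_transform_within_open)
        show "open {0<..<1::real}" "x \<in> {0<..<1}" using 1 by auto
        show "?g y = bump_fun p m y" if "y \<in> {0<..<1}" for y
          using that by (simp add: bump_fun_def pq)
      qed
    next
      case 2
      have "((\<lambda>x. 0) has_real_derivative bump_fun p' (m + 2) x) (at x)"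
        using 2 by (auto simp: bump_fun_def)
      then show ?thesis
      proof (rule has_field_derivative_transform_within_open)
        show "open (- {0..1::real})" "x \<in> - {0..1}" using 2 by auto
        show "0 = bump_fun p m y" if "y \<in> - {0..1}" for y
          using that by (auto simp: bump_fun_def)
      qed
    next
      case 3
      obtain C where "\<And>x y. x = 0 \<or> x = 1 \<Longrightarrow> \<bar>bump_fun p m y\<bar> \<le> C * (y - x)\<^sup>2"
        using bump_fun_quadratic_bound by blast
      then have "(bump_fun p m has_real_derivative 0) (at x)"
        using 3 by (intro has_real_derivative_zeroI)
      then show ?thesis
        using 3 by (auto simp: bump_fun_def)
    qed
  qed
  then show ?thesis by blast
qed

text \<open>The step is an antiderivative of the bump \<open>bump_fun 1 0\<close>, shifted and
  scaled to run from \<open>0\<close> to \<open>1\<close>. The bump is nonnegative, so the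
  antiderivative is monotone, and it is constant off the unit interval.\<close>

lemma smooth_step_exists:
  obtains \<Psi> \<psi> :: "real \<Rightarrow> real"
  where "smooth_fun \<Psi>" "\<And>x. (\<Psi> has_real_derivative \<psi> x) (at x)" "continuous_on UNIV \<psi>"
    "\<And>x. x \<le> 0 \<Longrightarrow> \<Psi> x = 0" "\<And>x. x \<ge> 1 \<Longrightarrow> \<Psi> x = 1" "\<And>x. x \<notin> {0..1} \<Longrightarrow> \<psi> x = 0"
    "\<And>x. 0 \<le> \<Psi> x" "\<And>x. \<Psi> x \<le> 1"
proof -
  let ?b = "bump_fun 1 0"
  have bpos: "?b x > 0" if "0 < x" "x < 1" for x
    using that by (simp add: bump_fun_def)
  have bnn: "?b x \<ge> 0" for x
    by (simp add: bump_fun_def)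
  have b0: "?b x = 0" if "\<not> (0 < x \<and> x < 1)" for x
    using that by (auto simp: bump_fun_def)
  have cb: "isCont ?b x" for x
    using bump_fun_has_derivative DERIV_isCont by blast
  obtain F where F: "\<And>x. (F has_real_derivative ?b x) (at x)"
    using einterval_antiderivative[of "-\<infinity>" "\<infinity>" ?b] cb
    by (auto simp: has_real_derivative_iff_has_vector_derivative)
  have mono: "F x \<le> F y" if "x \<le> y" for x y
    using that by (rule DERIV_nonneg_imp_nondecreasing) (use F bnn in blast)
  have F01: "F 0 < F 1"
    by (rule DERIV_pos_imp_increasing_open)
      (use F bpos in \<open>auto intro!: continuous_at_imp_continuous_on DERIV_isCont\<close>)
  have Fl: "F x = F 0" if "x \<le> 0" for x
  proof -
    have "F 0 \<le> F x" using that
      by (rule DERIV_nonpos_imp_nonincreasing) (use F b0 in \<open>metis linorder_not_less order_refl\<close>)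
    then show ?thesis using mono[OF that] by simp
  qed
  have Fr: "F x = F 1" if "x \<ge> 1" for x
  proof -
    have "F x \<le> F 1" using that
      by (rule DERIV_nonpos_imp_nonincreasing) (use F b0 in \<open>metis linorder_not_less order_refl\<close>)
    then show ?thesis using mono[OF that] by simp
  qed
  define c where "c = F 1 - F 0"
  have c: "c > 0" using F01 by (simp add: c_def)
  define \<Psi> where "\<Psi> x = (F x - F 0) / c" for x
  define \<psi> where "\<psi> x = ?b x / c" for x
  have d: "(\<Psi> has_real_derivative \<psi> x) (at x)" for x
    unfolding \<Psi>_def \<psi>_def by (rule derivative_eq_intros F refl | use c in simp)+
  \<comment> \<open>The step is no \<open>bump_fun\<close>, but one differentiation leads into the
    scaled family, which is closed from then on.\<close>
  define S where "S = {\<Psi>} \<union> {\<lambda>x. bump_fun p m x / c | p m. True}"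
  have "smooth_fun \<Psi>"
  proof (rule smooth_funI[of _ S])
    show "\<Psi> \<in> S" by (simp add: S_def)
    show "\<exists>f'\<in>S. \<forall>x. (f has_real_derivative f' x) (at x)" if "f \<in> S" for f
    proof (cases "f = \<Psi>")
      case True
      then show ?thesis using d by (intro bexI[of _ \<psi>]) (auto simp: S_def \<psi>_def[abs_def])
    next
      case False
      then obtain p m where f: "f = (\<lambda>x. bump_fun p m x / c)"
        using \<open>f \<in> S\<close> by (auto simp: S_def)
      obtain p' m' where p': "\<And>x. (bump_fun p m has_real_derivative bump_fun p' m' x) (at x)"
        using bump_fun_has_derivative by blast
      show ?thesis
        by (rule bexI[of _ "\<lambda>x. bump_fun p' m' x / c"]) (auto simp: S_def f intro!: DERIV_cdivide p')
    qed
  qed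
  moreover have "continuous_on UNIV \<psi>"
    unfolding \<psi>_def using cb c by (auto intro!: continuous_at_imp_continuous_on continuous_intros)
  moreover have "0 \<le> \<Psi> x" "\<Psi> x \<le> 1" for x
  proof -
    have "F 0 \<le> F x" "F x \<le> F 1"
      using mono[of 0 x] mono[of x 1] Fl[of x] Fr[of x] F01 by linarith+
    then show "0 \<le> \<Psi> x" "\<Psi> x \<le> 1"
      using c by (auto simp: \<Psi>_def c_def)
  qed
  moreover have "\<Psi> x = 0" if "x \<le> 0" for x
    using Fl[OF that] by (simp add: \<Psi>_def)
  moreover have "\<Psi> x = 1" if "x \<ge> 1" for x
    using Fr[OF that] c by (simp add: \<Psi>_def c_def)
  moreover have "\<psi> x = 0" if "x \<notin> {0..1}" for x
    using that b0[of x] by (auto simp: \<psi>_def)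
  ultimately show thesis
    using d that by blast
qed

lemma smooth_fun_two_scale:
  assumes "smooth_fun f" "smooth_fun g"
  shows "smooth_fun (\<lambda>x. f ((x - a) / e) - g ((x - c) / e))"
proof -
  \<comment> \<open>The free factor \<open>d\<close> absorbs the \<open>1 / e\<close> that each
    differentiation produces.\<close>
  define S where "S = {\<lambda>x. d * (f ((x - a) / e) - g ((x - c) / e)) | d f g. smooth_fun f \<and> smooth_fun g}"
  show ?thesis
  proof (rule smooth_funI[of _ S])
    show "(\<lambda>x. f ((x - a) / e) - g ((x - c) / e)) \<in> S"
      unfolding S_def using assms by (intro CollectI exI[of _ 1] exI[of _ f] exI[of _ g]) auto
    fix h assume "h \<in> S"
    then obtain d f g where h: "h = (\<lambda>x. d * (f ((x - a) / e) - g ((x - c) / e)))"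
      and fg: "smooth_fun f" "smooth_fun g"
      by (auto simp: S_def)
    let ?h' = "\<lambda>x. (d / e) * (deriv f ((x - a) / e) - deriv g ((x - c) / e))"
    have "(h has_real_derivative ?h' x) (at x)" for x
    proof -
      have 1: "((\<lambda>x. f ((x - a) / e)) has_real_derivative deriv f ((x - a) / e) * (1 / e)) (at x)"
        by (rule DERIV_chain2[OF smooth_fun_deriv(1)[OF fg(1)]])
          (rule DERIV_cdivide, auto intro!: derivative_eq_intros)
      have 2: "((\<lambda>x. g ((x - c) / e)) has_real_derivative deriv g ((x - c) / e) * (1 / e)) (at x)"
        by (rule DERIV_chain2[OF smooth_fun_deriv(1)[OF fg(2)]])
          (rule DERIV_cdivide, auto intro!: derivative_eq_intros)
      show ?thesis
        unfolding h using DERIV_cmult[OF DERIV_diff[OF 1 2], of d] by (simp add: algebra_simps)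
    qed
    moreover have "?h' \<in> S"
      unfolding S_def using fg smooth_fun_deriv(2) by blast
    ultimately show "\<exists>f'\<in>S. \<forall>x. (h has_real_derivative f' x) (at x)"
      by (intro bexI[of _ ?h']) auto
  qed
qed

section \<open>Convolution on the half-line\<close>

definition prim :: "(real \<Rightarrow> real) \<Rightarrow> real \<Rightarrow> real" where
  "prim p t = (\<integral>u. indicator {0..t} u * p u \<partial>lborel)"

text \<open>The convolution of the Laplace transform. Both arguments are read only on
  \<open>{0..t}\<close>, so each may be replaced there by a globally continuous or globally
  integrable version.\<close>

definition conv :: "(real \<Rightarrow> real) \<Rightarrow> (real \<Rightarrow> real) \<Rightarrow> real \<Rightarrow> real" where
  "conv p f t = (\<integral>u. indicator {0..t} u * (p u * f (t - u)) \<partial>lborel)"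

lemma prim_eq_conv: "prim p = conv p (\<lambda>_. 1)"
  by (simp add: prim_def conv_def fun_eq_iff)

lemma prim_0: "prim p 0 = 0"
  unfolding prim_def
proof (rule integral_eq_zero_AE)
  show "AE u in lborel. indicator {0..0} u * p u = 0"
    using AE_lborel_singleton[of "0::real"] by eventually_elim (auto simp: indicator_def)
qed

lemma conv_cong:
  assumes "\<And>x. 0 \<le> x \<Longrightarrow> x \<le> t \<Longrightarrow> f x = h x"
  shows "conv p f t = conv p h t"
  unfolding conv_def using assms
  by (intro Bochner_Integration.integral_cong) (auto simp: indicator_def)

lemma prim_cong:
  assumes "\<And>x. 0 \<le> x \<Longrightarrow> x \<le> t \<Longrightarrow> f x = h x"
  shows "prim f t = prim h t"
  unfolding prim_def using assms
  by (intro Bochner_Integration.integral_cong) (auto simp: indicator_def)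

lemma borel_measurable_prim [measurable]:
  assumes [measurable]: "p \<in> borel_measurable borel"
  shows "prim p \<in> borel_measurable borel"
proof -
  have "prim p = (\<lambda>t. \<integral>u. (if 0 \<le> u \<and> u \<le> t then p u else 0) \<partial>lborel)"
    unfolding prim_def by (intro ext Bochner_Integration.integral_cong) (auto simp: indicator_def)
  then show ?thesis by simp
qed

lemma abs_prim_le:
  assumes "integrable lborel p"
  shows "\<bar>prim p t\<bar> \<le> (\<integral>u. \<bar>p u\<bar> \<partial>lborel)"
proof -
  have "\<bar>prim p t\<bar> \<le> (\<integral>u. \<bar>indicator {0..t} u * p u\<bar> \<partial>lborel)"
    unfolding prim_def by (rule integral_abs_bound)
  also have "\<dots> \<le> (\<integral>u. \<bar>p u\<bar> \<partial>lborel)"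
  proof (rule integral_mono)
    show "integrable lborel (\<lambda>u. \<bar>indicator {0..t} u * p u\<bar>)"
      using integrable_mult_indicator[OF _ assms, of "{0..t}"] by (simp add: integrable_abs)
  qed (use assms in \<open>auto simp: indicator_def\<close>)
  finally show ?thesis .
qed

lemma integrable_conv_integrand:
  fixes p f :: "real \<Rightarrow> real"
  assumes p: "integrable lborel p" and [measurable]: "f \<in> borel_measurable borel"
    and f: "\<And>x. 0 \<le> x \<Longrightarrow> x \<le> t \<Longrightarrow> \<bar>f x\<bar> \<le> C"
  shows "integrable lborel (\<lambda>u. indicator {0..t} u * (p u * f (t - u)))"
proof (rule Bochner_Integration.integrable_bound)
  have [measurable]: "p \<in> borel_measurable borel"
    using borel_measurable_integrable[OF p] by simp
  show "(\<lambda>u. indicator {0..t} u * (p u * f (t - u))) \<in> borel_measurable lborel"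
    by measurable
  show "integrable lborel (\<lambda>u. C * p u)"
    using p by simp
  have "\<bar>p u * f (t - u)\<bar> \<le> \<bar>C * p u\<bar>" if "0 \<le> u" "u \<le> t" for u
    using f[of "t - u"] that by (auto simp: abs_mult mult.commute[of C] intro!: mult_left_mono)
  then show "AE u in lborel. norm (indicator {0..t} u * (p u * f (t - u))) \<le> norm (C * p u)"
    by (intro AE_I2) (auto simp: indicator_def)
qed

lemma abs_conv_le:
  assumes p: "integrable lborel p" and m: "f \<in> borel_measurable borel"
    and f: "\<And>x. 0 \<le> x \<Longrightarrow> x \<le> t \<Longrightarrow> \<bar>f x\<bar> \<le> C" and "C \<ge> 0"
  shows "\<bar>conv p f t\<bar> \<le> C * (\<integral>u. \<bar>p u\<bar> \<partial>lborel)"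
proof -
  have "\<bar>conv p f t\<bar> \<le> (\<integral>u. \<bar>indicator {0..t} u * (p u * f (t - u))\<bar> \<partial>lborel)"
    unfolding conv_def by (rule integral_abs_bound)
  also have "\<dots> \<le> (\<integral>u. C * \<bar>p u\<bar> \<partial>lborel)"
  proof (rule integral_mono)
    show "integrable lborel (\<lambda>u. \<bar>indicator {0..t} u * (p u * f (t - u))\<bar>)"
      using integrable_conv_integrand[OF p m f] by (simp add: integrable_abs)
    show "\<bar>indicator {0..t} u * (p u * f (t - u))\<bar> \<le> C * \<bar>p u\<bar>" for u
      using f[of "t - u"] \<open>C \<ge> 0\<close>
      by (auto simp: indicator_def abs_mult mult.commute[of C] intro!: mult_left_mono)
  qed (use p in auto)
  finally show ?thesis by simp
qed

lemma conv_diff: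
  assumes "integrable lborel p"
    and "f \<in> borel_measurable borel" "\<And>x. 0 \<le> x \<Longrightarrow> x \<le> t \<Longrightarrow> \<bar>f x\<bar> \<le> C"
    and "h \<in> borel_measurable borel" "\<And>x. 0 \<le> x \<Longrightarrow> x \<le> t \<Longrightarrow> \<bar>h x\<bar> \<le> D"
  shows "conv p (\<lambda>x. f x - h x) t = conv p f t - conv p h t"
  unfolding conv_def
  by (subst Bochner_Integration.integral_diff[symmetric, OF integrable_conv_integrand[OF assms(1-3)]
        integrable_conv_integrand[OF assms(1,4,5)]])
    (simp_all add: algebra_simps)

lemma conv_add:
  assumes "integrable lborel p"
    and "f \<in> borel_measurable borel" "\<And>x. 0 \<le> x \<Longrightarrow> x \<le> t \<Longrightarrow> \<bar>f x\<bar> \<le> C"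
    and "h \<in> borel_measurable borel" "\<And>x. 0 \<le> x \<Longrightarrow> x \<le> t \<Longrightarrow> \<bar>h x\<bar> \<le> D"
  shows "conv p (\<lambda>x. f x + h x) t = conv p f t + conv p h t"
  unfolding conv_def
  by (subst Bochner_Integration.integral_add[symmetric, OF integrable_conv_integrand[OF assms(1-3)]
        integrable_conv_integrand[OF assms(1,4,5)]])
    (simp_all add: algebra_simps)

text \<open>Dominated convergence with majorant \<open>C * \<bar>p u\<bar>\<close>, so a singularity
  of \<open>p\<close> does no harm. The moving endpoint can spoil pointwise convergence only at
  \<open>u = a\<close>, a null set.\<close>

lemma continuous_on_conv:
  assumes p: "integrable lborel p" and f: "continuous_on UNIV f"
  shows "continuous_on {0..b} (conv p f)"
  unfolding continuous_on_sequentially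
proof (intro allI ballI impI, elim conjE)
  fix X :: "nat \<Rightarrow> real" and a
  assume a: "a \<in> {0..b}" and X: "\<forall>n. X n \<in> {0..b}" "X \<longlonglongrightarrow> a"
  have [measurable]: "p \<in> borel_measurable borel" "f \<in> borel_measurable borel"
    using borel_measurable_integrable[OF p] borel_measurable_continuous_onI[OF f] by auto
  have "compact (f ` {0..b})"
    by (intro compact_continuous_image continuous_on_subset[OF f]) auto
  then obtain C where C: "\<And>x. x \<in> {0..b} \<Longrightarrow> \<bar>f x\<bar> \<le> C"
    using compact_imp_bounded by (fastforce simp: bounded_iff)
  have "(\<lambda>n. conv p f (X n)) \<longlonglongrightarrow> conv p f a"
    unfolding conv_def
  proof (rule integral_dominated_convergence)
    show "integrable lborel (\<lambda>u. C * \<bar>p u\<bar>)"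
      using p by simp
    show "AE u in lborel. norm (indicator {0..X n} u * (p u * f (X n - u))) \<le> C * \<bar>p u\<bar>" for n
    proof (intro AE_I2)
      fix u
      have "C \<ge> 0" using C[OF a] by linarith
      moreover have "\<bar>f (X n - u)\<bar> \<le> C" if "0 \<le> u" "u \<le> X n"
        using X(1)[rule_format, of n] that by (intro C) auto
      ultimately show "norm (indicator {0..X n} u * (p u * f (X n - u))) \<le> C * \<bar>p u\<bar>"
        by (auto simp: indicator_def abs_mult mult.commute[of C] intro!: mult_left_mono)
    qed
    show "AE u in lborel. (\<lambda>n. indicator {0..X n} u * (p u * f (X n - u)))
        \<longlonglongrightarrow> indicator {0..a} u * (p u * f (a - u))"
      using AE_lborel_singleton[of a]
    proof eventually_elim
      fix u assume "u \<noteq> a"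
      have "\<forall>\<^sub>F n in sequentially. indicat_real {0..X n} u = indicator {0..a} u"
      proof (cases "u < a")
        case True
        from order_tendstoD(1)[OF X(2) this] show ?thesis
          by eventually_elim (use True in \<open>auto simp: indicator_def\<close>)
      next
        case False
        then have "a < u" using \<open>u \<noteq> a\<close> by simp
        from order_tendstoD(2)[OF X(2) this] show ?thesis
          by eventually_elim (use \<open>a < u\<close> in \<open>auto simp: indicator_def\<close>)
      qed
      then have "(\<lambda>n. indicat_real {0..X n} u) \<longlonglongrightarrow> indicator {0..a} u"
        by (rule tendsto_eventually)
      moreover have "isCont f (a - u)"
        using f by (simp add: continuous_on_eq_continuous_at)
      then have "(\<lambda>n. f (X n - u)) \<longlonglongrightarrow> f (a - u)"
        by (rule isCont_tendsto_compose) (intro tendsto_intros X(2))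
      ultimately show "(\<lambda>n. indicator {0..X n} u * (p u * f (X n - u)))
          \<longlonglongrightarrow> indicator {0..a} u * (p u * f (a - u))"
        by (intro tendsto_intros)
    qed
  qed measurable
  then show "(conv p f \<circ> X) \<longlonglongrightarrow> conv p f a"
    by (simp add: o_def)
qed

lemma continuous_on_prim:
  "integrable lborel p \<Longrightarrow> continuous_on {0..b} (prim p)"
  unfolding prim_eq_conv by (rule continuous_on_conv) auto

lemma integrable_lborel_prod:
  fixes p q :: "real \<Rightarrow> real"
  assumes p: "integrable lborel p" and q: "integrable lborel q"
  shows "integrable (lborel \<Otimes>\<^sub>M lborel) (\<lambda>(x, y). p x * q y)"
proof (rule lborel_pair.Fubini_integrable)
  have [measurable]: "p \<in> borel_measurable lborel" "q \<in> borel_measurable lborel"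
    using p q by auto
  show "(\<lambda>(x, y). p x * q y) \<in> borel_measurable (lborel \<Otimes>\<^sub>M lborel)"
    by measurable
qed (use p q in \<open>auto simp: abs_mult\<close>)

text \<open>Both sides are the integral of \<open>p x * q u\<close> over the triangle
  \<open>x, u \<ge> 0\<close>, \<open>x + u \<le> s\<close>, evaluated in the two orders. This is
  what moves a derivative from one factor to the other.\<close>

lemma conv_prim_commute:
  assumes p: "integrable lborel p" and q: "integrable lborel q"
  shows "conv p (prim q) s = conv q (prim p) s"
proof -
  define h where "h x u = (if 0 \<le> x \<and> 0 \<le> u \<and> x + u \<le> s then p x * q u else 0)" for x u
  have [measurable]: "p \<in> borel_measurable borel" "q \<in> borel_measurable borel"
    using p q by (auto dest: borel_measurable_integrable)
  have "integrable (lborel \<Otimes>\<^sub>M lborel) (case_prod h)"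
  proof (rule Bochner_Integration.integrable_bound[OF integrable_lborel_prod[OF p q]])
    show "case_prod h \<in> borel_measurable (lborel \<Otimes>\<^sub>M lborel)"
      unfolding h_def by measurable
  qed (auto simp: h_def)
  from lborel_pair.Fubini_integral[OF this]
  have "(\<integral>u. (\<integral>x. h x u \<partial>lborel) \<partial>lborel) = (\<integral>x. (\<integral>u. h x u \<partial>lborel) \<partial>lborel)" .
  moreover have "(\<integral>u. h x u \<partial>lborel) = indicator {0..s} x * (p x * prim q (s - x))" for x
  proof (cases "0 \<le> x \<and> x \<le> s")
    case True
    then have "(\<integral>u. h x u \<partial>lborel) = (\<integral>u. p x * (indicator {0..s - x} u * q u) \<partial>lborel)"
      by (intro Bochner_Integration.integral_cong) (auto simp: h_def indicator_def)
    then show ?thesis using True by (simp add: prim_def)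
  next
    case False
    then have "h x u = 0" for u by (auto simp: h_def)
    then show ?thesis using False by (auto simp: indicator_def)
  qed
  moreover have "(\<integral>x. h x u \<partial>lborel) = indicator {0..s} u * (q u * prim p (s - u))" for u
  proof (cases "0 \<le> u \<and> u \<le> s")
    case True
    then have "(\<integral>x. h x u \<partial>lborel) = (\<integral>x. q u * (indicator {0..s - u} x * p x) \<partial>lborel)"
      by (intro Bochner_Integration.integral_cong) (auto simp: h_def indicator_def)
    then show ?thesis using True by (simp add: prim_def)
  next
    case False
    then have "h x u = 0" for x by (auto simp: h_def)
    then show ?thesis using False by (auto simp: indicator_def)
  qed
  ultimately show ?thesis
    by (simp add: conv_def)
qed

text \<open>Fubini on the triangle \<open>0 \<le> u \<le> t \<le> s\<close>, followed by the
  translation \<open>t = u + x\<close>. It exhibits the ABR integral as a primitive, ready to be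
  differentiated.\<close>

lemma prim_conv:
  assumes p: "integrable lborel p" and f: "continuous_on UNIV f"
  shows "prim (conv p f) s = conv p (prim f) s"
proof -
  define h where "h u t = (if 0 \<le> u \<and> u \<le> t \<and> t \<le> s then p u * f (t - u) else 0)" for u t
  have [measurable]: "p \<in> borel_measurable borel" "f \<in> borel_measurable borel"
    using borel_measurable_integrable[OF p] borel_measurable_continuous_onI[OF f] by auto
  have "compact (f ` {0..s})"
    by (intro compact_continuous_image continuous_on_subset[OF f]) auto
  then obtain C where C: "\<And>x. x \<in> {0..s} \<Longrightarrow> \<bar>f x\<bar> \<le> C"
    using compact_imp_bounded by (fastforce simp: bounded_iff)
  have "integrable lborel (\<lambda>t::real. C * indicator {0..s} t)"
    by (intro integrable_mult_right integrable_real_indicator) (auto simp: emeasure_lborel_Icc_eq)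
  from integrable_lborel_prod[OF p this]
  have "integrable (lborel \<Otimes>\<^sub>M lborel) (case_prod h)"
  proof (rule Bochner_Integration.integrable_bound)
    have "\<bar>h u t\<bar> \<le> \<bar>p u * (C * indicator {0..s} t)\<bar>" for u t
    proof (cases "0 \<le> u \<and> u \<le> t \<and> t \<le> s")
      case True
      then have "\<bar>f (t - u)\<bar> \<le> C" by (intro C) auto
      then show ?thesis using True by (auto simp: h_def abs_mult intro!: mult_left_mono)
    qed (auto simp: h_def)
    then show "AE x in lborel \<Otimes>\<^sub>M lborel. norm (case_prod h x)
        \<le> norm (case x of (u, t) \<Rightarrow> p u * (C * indicator {0..s} t))"
      by (intro AE_I2) (auto split: prod.split)
  qed (unfold h_def, measurable)
  from lborel_pair.Fubini_integral[OF this]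
  have "(\<integral>t. (\<integral>u. h u t \<partial>lborel) \<partial>lborel) = (\<integral>u. (\<integral>t. h u t \<partial>lborel) \<partial>lborel)" .
  moreover have "(\<integral>u. h u t \<partial>lborel) = indicator {0..s} t * conv p f t" for t
  proof (cases "0 \<le> t \<and> t \<le> s")
    case True
    then show ?thesis unfolding conv_def
      by (auto simp: h_def indicator_def intro!: Bochner_Integration.integral_cong)
  next
    case False
    then have "h u t = 0" for u by (auto simp: h_def)
    then show ?thesis using False by (auto simp: indicator_def)
  qed
  moreover have "(\<integral>t. h u t \<partial>lborel) = indicator {0..s} u * (p u * prim f (s - u))" for u
  proof (cases "0 \<le> u \<and> u \<le> s")
    case True
    have "(\<integral>t. h u t \<partial>lborel) = (\<integral>x. h u (u + 1 * x) \<partial>lborel)"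
      using lborel_integral_real_affine[of 1 "h u" u] by simp
    also have "\<dots> = (\<integral>x. p u * (indicator {0..s - u} x * f x) \<partial>lborel)"
      using True by (intro Bochner_Integration.integral_cong) (auto simp: h_def indicator_def)
    finally show ?thesis using True by (simp add: prim_def)
  next
    case False
    then have "h u t = 0" for t by (auto simp: h_def)
    then show ?thesis using False by (auto simp: indicator_def)
  qed
  ultimately show ?thesis
    by (simp add: conv_def prim_def)
qed

text \<open>The common source of both formulas. With \<open>p\<close> a weak derivative of
  \<open>f\<close> it acts as integration by parts, because \<open>prim p\<close> is then
  \<open>f - f 0\<close>; with \<open>p\<close> equal to \<open>f\<close> it prepares
  \<open>prim_conv\<close>.\<close>

lemma conv_one_plus_prim:
  assumes p: "integrable lborel p" and k: "integrable lborel k"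
  shows "conv p (\<lambda>y. 1 + prim k y) s = prim p s + conv k (prim p) s"
proof -
  have [measurable]: "k \<in> borel_measurable borel"
    using k by (auto dest: borel_measurable_integrable)
  have "conv p (\<lambda>y. 1 + prim k y) s = conv p (\<lambda>_. 1) s + conv p (prim k) s"
    by (rule conv_add[OF p]) (auto intro: abs_prim_le[OF k])
  then show ?thesis
    by (simp add: prim_eq_conv[symmetric] conv_prim_commute[OF p k])
qed

lemma prim_eq_integral:
  assumes "continuous_on {0..b} f" "s \<le> b"
  shows "prim f s = integral {0..s} f"
proof -
  have "set_integrable lborel {0..s} f"
    by (rule borel_integrable_compact[of "{0..s}" f, folded set_integrable_def])
      (use assms in \<open>auto intro: continuous_on_subset\<close>)
  from set_borel_integral_eq_integral(2)[OF this] show ?thesis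
    by (simp add: prim_def set_lebesgue_integral_def)
qed

section \<open>The Mittag-Leffler kernel\<close>

text \<open>Restrict Euler's integral to \<open>{R..}\<close>, where \<open>t powr x\<close> is at
  least \<open>R powr x\<close>.\<close>

lemma Gamma_ge_powr_exp:
  fixes R x :: real
  assumes "R \<ge> 0" "x \<ge> 0"
  shows "R powr x * exp (- R) \<le> Gamma (x + 1)"
proof -
  have "((\<lambda>t. exp (-1 * t)) has_integral exp (- 1 * R) / 1) {R..}"
    by (rule has_integral_exp_minus_to_infinity) simp
  then have "((\<lambda>t. R powr x * exp (- t)) has_integral R powr x * exp (- R)) {R..}"
    by (intro has_integral_mult_right) simp
  then have "((\<lambda>t. if t \<in> {R..} then R powr x * exp (- t) else 0) has_integral R powr x * exp (- R)) {0..}"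
    using assms by (subst has_integral_restrict) auto
  moreover have "((\<lambda>t. t powr (x + 1 - 1) / exp t) has_integral Gamma (x + 1)) {0..}"
    using assms by (intro Gamma_integral_real) auto
  ultimately show ?thesis
    by (rule has_integral_le)
      (use assms in \<open>auto simp: exp_minus field_simps intro!: powr_mono2\<close>)
qed

text \<open>For \<alpha> > 0 the values \<open>Gamma (\<alpha> * k + 1)\<close> outgrow every
  geometric sequence \<open>w ^ k\<close>: take \<open>R\<close> with
  \<open>R powr \<alpha> = w\<close> in the bound above and pay only the constant
  \<open>exp (- R)\<close>.\<close>

lemma summable_mittag_leffler:
  assumes "\<alpha> > 0"
  shows "summable (\<lambda>k. 1 / Gamma (\<alpha> * real k + 1) * z ^ k)"
proof (rule summable_comparison_test')
  \<comment> \<open>Large enough for the ratio \<open>\<bar>z\<bar> / w\<close> to be at most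
    \<open>1 / 2\<close>, and positive even at \<open>z = 0\<close>.\<close>
  define w where "w = 2 * (\<bar>z\<bar> + 1)"
  define R where "R = w powr (1 / \<alpha>)"
  have w: "w > 0" by (simp add: w_def)
  show "summable (\<lambda>k. exp R * (1 / 2) ^ k)"
    by (intro summable_mult summable_geometric) auto
  fix k :: nat
  have "R powr (\<alpha> * real k) = w ^ k"
    using assms w by (simp add: R_def powr_powr powr_realpow)
  then have G: "w ^ k * exp (- R) \<le> Gamma (\<alpha> * real k + 1)"
    using Gamma_ge_powr_exp[of R "\<alpha> * real k"] assms by (simp add: R_def)
  have pos: "0 < w ^ k * exp (- R)"
    using w by simp
  have "norm (1 / Gamma (\<alpha> * real k + 1) * z ^ k) = \<bar>z\<bar> ^ k / Gamma (\<alpha> * real k + 1)"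
    using G pos by (simp add: abs_mult power_abs)
  also have "\<dots> \<le> \<bar>z\<bar> ^ k / (w ^ k * exp (- R))"
    using G pos by (intro divide_left_mono) auto
  also have "\<dots> = exp R * (\<bar>z\<bar> / w) ^ k"
    by (simp add: exp_minus power_divide field_simps)
  also have "\<dots> \<le> exp R * (1 / 2) ^ k"
    using w by (intro mult_left_mono power_mono) (auto simp: w_def field_simps)
  finally show "norm (1 / Gamma (\<alpha> * real k + 1) * z ^ k) \<le> exp R * (1 / 2) ^ k" .
qed

lemma mittag_leffler_0_right: "mittag_leffler \<alpha> 0 = 1"
proof -
  have "(\<lambda>k. (0::real) ^ k / Gamma (\<alpha> * real k + 1)) sums (\<Sum>k\<in>{0}. 0 ^ k / Gamma (\<alpha> * real k + 1))"
    by (rule sums_finite) auto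
  then show ?thesis
    by (simp add: mittag_leffler_def sums_iff)
qed

lemma mittag_leffler_has_continuous_derivative:
  assumes "\<alpha> > 0"
  obtains e' where "\<And>z. (mittag_leffler \<alpha> has_real_derivative e' z) (at z)" "continuous_on UNIV e'"
proof -
  define c where "c k = 1 / Gamma (\<alpha> * real k + 1)" for k :: nat
  have s: "summable (\<lambda>k. c k * z ^ k)" for z
    unfolding c_def by (rule summable_mittag_leffler[OF assms])
  have "mittag_leffler \<alpha> = (\<lambda>z. \<Sum>k. c k * z ^ k)"
    by (simp add: mittag_leffler_def c_def fun_eq_iff)
  then have "(mittag_leffler \<alpha> has_real_derivative (\<Sum>k. diffs c k * z ^ k)) (at z)" for z
    using termdiffs_strong_converges_everywhere[OF s] by simp
  moreover have "continuous_on UNIV (\<lambda>z. \<Sum>k. diffs c k * z ^ k)"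
    by (intro continuous_at_imp_continuous_on ballI isCont_powser_converges_everywhere
        termdiff_converges_all s)
  ultimately show thesis
    by (rule that)
qed

text \<open>By the chain rule \<open>k\<close> is a continuous function times
  \<open>s powr (\<alpha> - 1)\<close>, and the exponent exceeds \<open>-1\<close>. It is cut off
  outside \<open>{0..b}\<close> to be integrable on the whole line.\<close>

lemma mittag_leffler_kernel_primitive:
  assumes "0 \<le> \<alpha>" "\<alpha> < 1" "b > 0"
  obtains k where "integrable lborel k"
    "\<And>s. 0 \<le> s \<Longrightarrow> s \<le> b \<Longrightarrow> mittag_leffler \<alpha> (- \<alpha> * (s powr \<alpha> / (1 - \<alpha>)))
       = 1 + prim k s"
proof (cases "\<alpha> = 0")
  case True
  \<comment> \<open>At \<alpha> = 0 the kernel is evaluated only at argument \<open>0\<close>, hence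
    is constantly \<open>1\<close>.\<close>
  show thesis
    by (rule that[of "\<lambda>_. 0"]) (auto simp: True mittag_leffler_0_right prim_def)
next
  case False
  then have \<alpha>: "\<alpha> > 0" using assms by simp
  obtain e' where e': "\<And>z. (mittag_leffler \<alpha> has_real_derivative e' z) (at z)"
    and ce': "continuous_on UNIV e'"
    using mittag_leffler_has_continuous_derivative[OF \<alpha>] by blast
  define \<mu> where "\<mu> = - \<alpha> / (1 - \<alpha>)"
  define K where "K s = mittag_leffler \<alpha> (\<mu> * s powr \<alpha>)" for s
  define k where "k s = e' (\<mu> * s powr \<alpha>) * (\<mu> * (\<alpha> * s powr (\<alpha> - 1)))" for s
  have contp: "continuous_on {0..b} (\<lambda>s. \<mu> * s powr \<alpha>)"
    using \<alpha> by (intro continuous_on_mult continuous_on_powr' continuous_on_id continuous_on_const) auto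
  have "compact ((\<lambda>s. e' (\<mu> * s powr \<alpha>)) ` {0..b})"
    by (intro compact_continuous_image continuous_on_compose2[OF ce' contp]) auto
  then obtain C where C: "\<And>s. s \<in> {0..b} \<Longrightarrow> \<bar>e' (\<mu> * s powr \<alpha>)\<bar> \<le> C"
    using compact_imp_bounded by (fastforce simp: bounded_iff)
  have [measurable]: "e' \<in> borel_measurable borel"
    using ce' by (rule borel_measurable_continuous_onI)
  have km [measurable]: "k \<in> borel_measurable borel"
    unfolding k_def by measurable
  have "(\<lambda>s. s powr (\<alpha> - 1)) integrable_on {0..b}"
    by (rule integrable_on_powr_from_0) (use \<alpha> assms in auto)
  then have "(\<lambda>s. s powr (\<alpha> - 1)) absolutely_integrable_on {0..b}"
    by (subst absolutely_integrable_on_iff_nonneg) auto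
  from integrable_mult_right[OF this [unfolded set_integrable_def], of "C * \<bar>\<mu>\<bar> * \<alpha>"]
  have "integrable lborel (\<lambda>s. C * \<bar>\<mu>\<bar> * \<alpha> * (indicat_real {0..b} s *\<^sub>R (s powr (\<alpha> - 1))))"
    by (subst (asm) integrable_completion) auto
  then have ik: "integrable lborel (\<lambda>s. indicator {0..b} s * k s)"
  proof (rule Bochner_Integration.integrable_bound)
    have "\<bar>k s\<bar> \<le> \<bar>C * \<bar>\<mu>\<bar> * \<alpha> * s powr (\<alpha> - 1)\<bar>" if "s \<in> {0..b}" for s
    proof -
      have "\<bar>k s\<bar> = \<bar>e' (\<mu> * s powr \<alpha>)\<bar> * (\<bar>\<mu>\<bar> * \<alpha> * s powr (\<alpha> - 1))"
        using \<alpha> by (simp add: k_def abs_mult)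
      also have "\<dots> \<le> C * (\<bar>\<mu>\<bar> * \<alpha> * s powr (\<alpha> - 1))"
        using C[OF that] \<alpha> by (intro mult_right_mono) auto
      finally show ?thesis by (simp add: mult_ac)
    qed
    then show "AE s in lborel. norm (indicator {0..b} s * k s)
        \<le> norm (C * \<bar>\<mu>\<bar> * \<alpha> * (indicat_real {0..b} s *\<^sub>R (s powr (\<alpha> - 1))))"
      by (intro AE_I2) (auto simp: indicator_def)
  qed measurable
  have "K s = 1 + prim (\<lambda>u. indicator {0..b} u * k u) s" if s: "0 \<le> s" "s \<le> b" for s
  proof -
    have "continuous_on {0..b} K"
      unfolding K_def
      by (rule continuous_on_compose2[OF _ contp, of UNIV])
        (auto intro!: continuous_at_imp_continuous_on DERIV_isCont e')
    then have cK: "continuous_on {0..s} K"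
      by (rule continuous_on_subset) (use s in auto)
    \<comment> \<open>\<open>k\<close> is singular at \<open>0\<close>, so the fundamental theorem
      is used in the form that asks for continuity on the closed interval and a derivative only
      inside it.\<close>
    have "(k has_integral K s - K 0) {0..s}"
    proof (rule fundamental_theorem_of_calculus_interior[OF s(1) cK])
      fix x assume "x \<in> {0<..<s}"
      then have x: "x > 0" by simp
      have "((\<lambda>s. \<mu> * s powr \<alpha>) has_real_derivative \<mu> * (\<alpha> * x powr (\<alpha> - 1))) (at x)"
        using x by (auto intro!: derivative_eq_intros)
      from DERIV_chain2[OF e' this] show "(K has_vector_derivative k x) (at x)"
        by (simp add: K_def[abs_def] k_def has_real_derivative_iff_has_vector_derivative)
    qed
    then have K: "K s - K 0 = integral {0..s} k"
      by (simp add: integral_unique)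
    have "integrable lborel (\<lambda>u. indicator {0..s} u *\<^sub>R (indicator {0..b} u * k u))"
      using integrable_mult_indicator[OF _ ik, of "{0..s}"] by simp
    also have "(\<lambda>u. indicator {0..s} u *\<^sub>R (indicator {0..b} u * k u)) = (\<lambda>u. indicator {0..s} u *\<^sub>R k u)"
      using s by (auto simp: fun_eq_iff indicator_def)
    finally have "set_integrable lborel {0..s} k"
      by (simp add: set_integrable_def)
    from set_borel_integral_eq_integral(2)[OF this]
    have "integral {0..s} k = (\<integral>u. indicator {0..s} u * k u \<partial>lborel)"
      by (simp add: set_lebesgue_integral_def)
    also have "\<dots> = prim (\<lambda>u. indicator {0..b} u * k u) s"
      unfolding prim_def using s by (intro Bochner_Integration.integral_cong) (auto simp: indicator_def)
    finally show ?thesis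
      using K by (simp add: K_def mittag_leffler_0_right)
  qed
  then show thesis
    by (intro that[OF ik]) (simp add: K_def \<mu>_def)
qed

section \<open>Weak derivatives\<close>

text \<open>Extension by the boundary values. It turns continuity on \<open>{0..b}\<close> into
  continuity and boundedness on the whole line, and so gives Borel measurability although
  \<open>f\<close> is arbitrary outside \<open>{0..b}\<close>.\<close>

definition clamp_fun :: "real \<Rightarrow> (real \<Rightarrow> real) \<Rightarrow> real \<Rightarrow> real" where
  "clamp_fun b f x = f (max 0 (min b x))"

lemma clamp_fun_eq: "x \<in> {0..b} \<Longrightarrow> clamp_fun b f x = f x"
  by (simp add: clamp_fun_def)

lemma continuous_on_clamp_fun:
  "0 \<le> b \<Longrightarrow> continuous_on {0..b} f \<Longrightarrow> continuous_on UNIV (clamp_fun b f)"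
  unfolding clamp_fun_def
  by (rule continuous_on_compose2[of "{0..b}" f]) (auto intro!: continuous_intros)

text \<open>A weak derivative is only Lebesgue measurable and only known on the open interval,
  whereas \<open>prim\<close> and \<open>conv\<close> are integrals over \<open>lborel\<close>. The
  set \<open>S\<close> is general because the result serves both \<open>{0<..<b}\<close>, where test
  functions act, and \<open>{0..t}\<close>, where the ABC integral lives.\<close>

lemma square_integrable_borel_version:
  assumes g: "square_integrable b g"
  obtains g1 where "integrable lborel g1"
    "\<And>S h. S \<in> sets borel \<Longrightarrow> S \<subseteq> {0..b} \<Longrightarrow> h \<in> borel_measurable borel \<Longrightarrow>
      (LINT x|lebesgue_on S. g x * h x) = (\<integral>x. indicator S x * (g1 x * h x) \<partial>lborel)"
proof -
  define G where "G x = indicator {0<..<b} x * g x" for x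
  have gm: "g \<in> borel_measurable (lebesgue_on {0<..<b})"
    and g2: "integrable (lebesgue_on {0<..<b}) (\<lambda>x. (g x)\<^sup>2)"
    using g by (auto simp: square_integrable_def)
  have Gm [measurable]: "G \<in> borel_measurable lebesgue"
    using gm unfolding G_def
    by (subst (asm) borel_measurable_restrict_space_iff) (auto simp: mult.commute)
  have "integrable (lebesgue_on {0<..<b}) (\<lambda>x. 1 + (g x)\<^sup>2)"
    by (intro Bochner_Integration.integrable_add g2 finite_measure.integrable_const
        finite_measure_lebesgue_on) auto
  then have "integrable (lebesgue_on {0<..<b}) g"
  proof (rule Bochner_Integration.integrable_bound[OF _ gm])
    \<comment> \<open>This puts L2 into L1 on an interval of finite length.\<close>
    have "\<bar>y\<bar> \<le> \<bar>1 + y\<^sup>2\<bar>" for y :: real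
    proof -
      have "0 \<le> (\<bar>y\<bar> - 1)\<^sup>2 + \<bar>y\<bar>" by simp
      then show ?thesis by (simp add: power2_eq_square algebra_simps)
    qed
    then show "AE x in lebesgue_on {0<..<b}. norm (g x) \<le> norm (1 + (g x)\<^sup>2)"
      by simp
  qed
  then have Gi: "integrable lebesgue G"
    by (subst (asm) integrable_restrict_space) (auto simp: G_def[abs_def])
  obtain g1 where g1 [measurable]: "g1 \<in> borel_measurable lborel" and ae: "AE x in lborel. G x = g1 x"
    using completion_ex_borel_measurable_real[OF Gm] by blast
  have ae': "AE x in lebesgue. G x = g1 x"
    using ae by (rule AE_completion)
  have g1': "g1 \<in> borel_measurable lebesgue"
    using measurable_completion[OF g1] .
  have "integrable lebesgue g1"
    by (rule integrable_cong_AE_imp[OF Gi g1']) (use ae' in \<open>auto elim: eventually_mono\<close>)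
  then have i1: "integrable lborel g1"
    using integrable_completion[OF g1] by simp
  show thesis
  proof (rule that[OF i1])
    fix S :: "real set" and h :: "real \<Rightarrow> real"
    assume S [measurable]: "S \<in> sets borel" and Sb: "S \<subseteq> {0..b}" and h [measurable]: "h \<in> borel_measurable borel"
    have Sl [measurable]: "S \<in> sets lebesgue" using S by simp
    have hl [measurable]: "h \<in> borel_measurable lebesgue"
      by (rule measurable_completion) (use h in simp)
    have S0: "{0} \<inter> S \<in> sets lebesgue" "{b} \<inter> S - {0} \<in> sets lebesgue"
      by simp_all
    \<comment> \<open>\<open>g\<close> may take any values at \<open>0\<close> and \<open>b\<close>.
      Splitting these points off keeps the integrand measurable; removing \<open>0\<close> from the
      last set avoids counting one point twice when \<open>b = 0\<close>.\<close>
    have split: "indicator S x *\<^sub>R (g x * h x) = indicator S x * (G x * h x)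
        + indicator ({0} \<inter> S) x * (g 0 * h 0) + indicator ({b} \<inter> S - {0}) x * (g b * h b)" for x
      using Sb by (auto simp: G_def indicator_def)
    have m: "(\<lambda>x. indicator S x *\<^sub>R (g x * h x)) \<in> borel_measurable lebesgue"
      unfolding split using S0 by measurable
    have "(LINT x|lebesgue_on S. g x * h x) = (\<integral>x. indicator S x *\<^sub>R (g x * h x) \<partial>lebesgue)"
      by (rule integral_restrict_space) simp
    also have "\<dots> = (\<integral>x. indicator S x * (g1 x * h x) \<partial>lebesgue)"
    proof (rule integral_cong_AE[OF m])
      show "(\<lambda>x. indicator S x * (g1 x * h x)) \<in> borel_measurable lebesgue"
        using g1' by measurable
      have "AE x in lebesgue. x \<noteq> 0" "AE x in lebesgue. x \<noteq> b"
        by (intro AE_completion AE_lborel_singleton)+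
      then show "AE x in lebesgue. indicator S x *\<^sub>R (g x * h x) = indicator S x * (g1 x * h x)"
        using ae'
      proof eventually_elim
        case (elim x)
        then show ?case using Sb by (auto simp: G_def indicator_def split: if_splits)
      qed
    qed
    also have "\<dots> = (\<integral>x. indicator S x * (g1 x * h x) \<partial>lborel)"
    proof (rule integral_completion)
      show "(\<lambda>x. indicator S x * (g1 x * h x)) \<in> borel_measurable lborel"
        using S h by measurable
    qed
    finally show "(LINT x|lebesgue_on S. g x * h x) = (\<integral>x. indicator S x * (g1 x * h x) \<partial>lborel)" .
  qed
qed

lemma integral_lebesgue_on_borel:
  fixes f h :: "real \<Rightarrow> real"
  assumes "S \<in> sets borel" "\<And>x. x \<in> S \<Longrightarrow> f x = h x" "h \<in> borel_measurable borel"
  shows "(LINT x|lebesgue_on S. f x) = (\<integral>x. indicator S x * h x \<partial>lborel)"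
proof -
  have "(LINT x|lebesgue_on S. f x) = (LINT x|lebesgue_on S. h x)"
    using assms(1,2) by (intro Bochner_Integration.integral_cong) auto
  also have "\<dots> = (\<integral>x. indicator S x *\<^sub>R h x \<partial>lebesgue)"
    by (rule integral_restrict_space) (use assms(1) in auto)
  also have "\<dots> = (\<integral>x. indicator S x *\<^sub>R h x \<partial>lborel)"
    by (rule integral_completion) (use assms(1,3) in measurable)
  finally show ?thesis by simp
qed

text \<open>An approximate identity with moving centres, as the flanks of the test functions move
  towards \<open>0\<close> and \<open>t\<close> while they steepen. The substitution
  \<open>x = a n + e n * y\<close> leaves a fixed \<psi>, and dominated convergence applies.\<close>

lemma mollify_tendsto:
  fixes \<psi> f :: "real \<Rightarrow> real"
  assumes f: "continuous_on UNIV f" "\<And>x. \<bar>f x\<bar> \<le> C"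
    and \<psi>: "integrable lborel \<psi>"
    and a: "a \<longlonglongrightarrow> l" and e: "e \<longlonglongrightarrow> 0" "\<And>n. e n > 0"
  shows "(\<lambda>n. \<integral>x. f x * (\<psi> ((x - a n) / e n) / e n) \<partial>lborel) \<longlonglongrightarrow> f l * (\<integral>y. \<psi> y \<partial>lborel)"
proof -
  have [measurable]: "f \<in> borel_measurable borel" "\<psi> \<in> borel_measurable borel"
    using borel_measurable_integrable[OF \<psi>] borel_measurable_continuous_onI[OF f(1)] by auto
  have "(\<integral>x. f x * (\<psi> ((x - a n) / e n) / e n) \<partial>lborel) = (\<integral>y. f (a n + e n * y) * \<psi> y \<partial>lborel)" for n
    using e(2)[of n] lborel_integral_real_affine[of "e n" "\<lambda>x. f x * (\<psi> ((x - a n) / e n) / e n)" "a n"]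
    by simp
  moreover have "(\<lambda>n. \<integral>y. f (a n + e n * y) * \<psi> y \<partial>lborel) \<longlonglongrightarrow> (\<integral>y. f l * \<psi> y \<partial>lborel)"
  proof (rule integral_dominated_convergence)
    show "integrable lborel (\<lambda>y. C * \<bar>\<psi> y\<bar>)"
      using \<psi> by simp
    show "AE y in lborel. norm (f (a n + e n * y) * \<psi> y) \<le> C * \<bar>\<psi> y\<bar>" for n
      using f(2) by (intro AE_I2) (auto simp: abs_mult intro!: mult_right_mono)
    have "(\<lambda>n. f (a n + e n * y) * \<psi> y) \<longlonglongrightarrow> f l * \<psi> y" for y
    proof (intro tendsto_intros)
      have "(\<lambda>n. a n + e n * y) \<longlonglongrightarrow> l + 0 * y"
        by (intro tendsto_intros a e)
      moreover have "isCont f l"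
        using f(1) by (simp add: continuous_on_eq_continuous_at)
      ultimately show "(\<lambda>n. f (a n + e n * y)) \<longlonglongrightarrow> f l"
        by (intro isCont_tendsto_compose[of l f]) auto
    qed
    then show "AE y in lborel. (\<lambda>n. f (a n + e n * y) * \<psi> y) \<longlonglongrightarrow> f l * \<psi> y"
      by simp
  qed measurable
  ultimately show ?thesis by simp
qed

text \<open>
  The test functions are smoothed indicators of \<open>{0..t}\<close>: they rise from \<open>0\<close> to \<open>1\<close> on
  \<open>{\<epsilon>..2 * \<epsilon>}\<close> and fall back on \<open>{t - 2 * \<epsilon>..t - \<epsilon>}\<close>.
\<close>

lemma L2_weak_derivative_primitive:
  assumes b: "b > 0" and f: "continuous_on {0..b} f" and g: "L2_weak_derivative b f g"
    and g1: "integrable lborel g1"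
    and gg1: "\<And>h. h \<in> borel_measurable borel \<Longrightarrow>
      (LINT x|lebesgue_on {0<..<b}. g x * h x) = (\<integral>x. indicator {0<..<b} x * (g1 x * h x) \<partial>lborel)"
    and t: "t \<in> {0..b}"
  shows "f t = f 0 + prim g1 t"
proof (cases "t = 0")
  case True
  then show ?thesis by (simp add: prim_0)
next
  case False
  then have t0: "0 < t" "t \<le> b" using t by auto
  define F where "F = clamp_fun b f"
  have F: "continuous_on UNIV F"
    unfolding F_def using b f by (intro continuous_on_clamp_fun) auto
  have [measurable]: "F \<in> borel_measurable borel" "g1 \<in> borel_measurable borel"
    using borel_measurable_integrable[OF g1] borel_measurable_continuous_onI[OF F] by auto
  have "compact (f ` {0..b})"
    by (intro compact_continuous_image f) auto
  then obtain C where C: "\<And>x. x \<in> {0..b} \<Longrightarrow> \<bar>f x\<bar> \<le> C"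
    using compact_imp_bounded by (fastforce simp: bounded_iff)
  have FC: "\<bar>F x\<bar> \<le> C" for x
    unfolding F_def clamp_fun_def using b by (intro C) auto
  obtain \<Psi> \<psi> :: "real \<Rightarrow> real" where sm: "smooth_fun \<Psi>"
    and d\<Psi>: "\<And>x. (\<Psi> has_real_derivative \<psi> x) (at x)" and c\<psi>: "continuous_on UNIV \<psi>"
    and \<Psi>0: "\<And>x. x \<le> 0 \<Longrightarrow> \<Psi> x = 0" and \<Psi>1: "\<And>x. x \<ge> 1 \<Longrightarrow> \<Psi> x = 1"
    and \<psi>0: "\<And>x. x \<notin> {0..1} \<Longrightarrow> \<psi> x = 0" and \<Psi>b: "\<And>x. 0 \<le> \<Psi> x" "\<And>x. \<Psi> x \<le> 1"
    using smooth_step_exists by metis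
  have "continuous_on UNIV \<Psi>"
    using d\<Psi> by (auto intro!: continuous_at_imp_continuous_on DERIV_isCont)
  then have [measurable]: "\<Psi> \<in> borel_measurable borel" "\<psi> \<in> borel_measurable borel"
    using c\<psi> by (auto intro: borel_measurable_continuous_onI)
  have "(\<psi> has_integral \<Psi> 1 - \<Psi> 0) {0..1}"
    by (rule fundamental_theorem_of_calculus)
      (use d\<Psi> in \<open>auto simp: has_real_derivative_iff_has_vector_derivative
        intro: has_vector_derivative_at_within\<close>)
  then have I1: "integral {0..1} \<psi> = 1"
    using \<Psi>0[of 0] \<Psi>1[of 1] by (simp add: integral_unique)
  have ind: "indicator {0..1} x * \<psi> x = \<psi> x" for x
    using \<psi>0[of x] by (auto simp: indicator_def)
  have i\<psi>: "integrable lborel \<psi>"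
    using borel_integrable_compact[of "{0..1}" \<psi>] c\<psi> unfolding real_scaleR_def ind
    by (auto intro: continuous_on_subset)
  have \<psi>1: "(\<integral>y. \<psi> y \<partial>lborel) = 1"
    using prim_eq_integral[of 1 \<psi> 1] continuous_on_subset[OF c\<psi>] I1 unfolding prim_def ind by simp

  \<comment> \<open>The factor \<open>4\<close> keeps the two flanks apart,
    \<open>2 * e n \<le> t - 2 * e n\<close>, and the support stays inside \<open>{0<..<b}\<close>
    even for \<open>t = b\<close>.\<close>
  define e where "e n = t / (4 * real (Suc n))" for n
  have e: "0 < e n" "4 * e n \<le> t" for n
    using t0 by (auto simp: e_def field_simps)
  have elim: "e \<longlonglongrightarrow> 0"
    using tendsto_mult[OF tendsto_const[of "t / 4"] LIMSEQ_inverse_real_of_nat]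
    by (simp add: e_def[abs_def] field_simps)
  define \<phi> where "\<phi> n x = \<Psi> ((x - e n) / e n) - \<Psi> ((x - (t - 2 * e n)) / e n)" for n x
  have \<phi>_left: "\<phi> n x = 0" if "x \<le> e n" for n x
    using that e[of n] \<Psi>0 by (simp add: \<phi>_def divide_le_0_iff)
  have \<phi>_right: "\<phi> n x = 0" if "x \<ge> t - e n" for n x
    using that e[of n] \<Psi>1 by (simp add: \<phi>_def le_divide_eq)
  have \<phi>_mid: "\<phi> n x = 1" if "2 * e n \<le> x" "x \<le> t - 2 * e n" for n x
    using that e[of n] \<Psi>1 \<Psi>0 by (simp add: \<phi>_def le_divide_eq divide_le_0_iff)
  have \<phi>_bound: "\<bar>\<phi> n x\<bar> \<le> 1" for n x
    using \<Psi>b[of "(x - e n) / e n"] \<Psi>b[of "(x - (t - 2 * e n)) / e n"]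
    by (simp add: \<phi>_def abs_le_iff)
  have test: "test_function b (\<phi> n)" for n
  proof -
    have "smooth_fun (\<phi> n)"
      unfolding \<phi>_def by (rule smooth_fun_two_scale[OF sm sm])
    moreover have "closure {x. \<phi> n x \<noteq> 0} \<subseteq> {e n..t - e n}"
      by (rule closure_minimal) (use \<phi>_left \<phi>_right in \<open>auto simp: not_less[symmetric]\<close>)
    moreover have "{e n..t - e n} \<subseteq> {0<..<b}"
      using e[of n] t0 by auto
    ultimately show ?thesis
      unfolding test_function_def smooth_fun_def by blast
  qed
  have d\<phi>: "deriv (\<phi> n) x = \<psi> ((x - e n) / e n) / e n - \<psi> ((x - (t - 2 * e n)) / e n) / e n" for n x
  proof -
    have "((\<lambda>x. \<Psi> ((x - a) / e n)) has_real_derivative \<psi> ((x - a) / e n) * (1 / e n)) (at x)" for a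
      by (rule DERIV_chain2[OF d\<Psi>], rule DERIV_cdivide, auto intro!: derivative_eq_intros)
    from DERIV_diff[OF this this] show ?thesis
      by (intro DERIV_imp_deriv) (simp add: \<phi>_def[abs_def])
  qed
  have d\<phi>0: "deriv (\<phi> n) x = 0" if "x \<notin> {0<..<b}" for n x
  proof -
    have "(x - e n) / e n \<notin> {0..1}" "(x - (t - 2 * e n)) / e n \<notin> {0..1}"
      using that e[of n] t0 by (auto simp: field_simps)
    then show ?thesis by (simp add: d\<phi> \<psi>0)
  qed
  have m1 [measurable]: "\<phi> n \<in> borel_measurable borel" for n
    unfolding \<phi>_def by measurable
  have m2 [measurable]: "deriv (\<phi> n) \<in> borel_measurable borel" for n
    unfolding d\<phi>[abs_def] by measurable
  have iF: "integrable lborel (\<lambda>x. F x * (\<psi> ((x - a) / e n) / e n))" for a n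
  proof (rule Bochner_Integration.integrable_bound)
    have "integrable lborel (\<lambda>x. \<psi> (- a / e n + (1 / e n) * x))"
      using e[of n] by (intro lborel_integrable_real_affine i\<psi>) auto
    then show "integrable lborel (\<lambda>x. C * (\<psi> ((x - a) / e n) / e n))"
      by (simp add: diff_divide_distrib)
    show "AE x in lborel. norm (F x * (\<psi> ((x - a) / e n) / e n)) \<le> norm (C * (\<psi> ((x - a) / e n) / e n))"
    proof (intro AE_I2)
      fix x
      have "\<bar>F x\<bar> \<le> \<bar>C\<bar>" using FC[of x] by linarith
      then show "norm (F x * (\<psi> ((x - a) / e n) / e n)) \<le> norm (C * (\<psi> ((x - a) / e n) / e n))"
        unfolding real_norm_def abs_mult by (rule mult_right_mono) simp
    qed
  qed measurable
  \<comment> \<open>The defining identity of the weak derivative, tested with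
    \<open>\<phi> n\<close>. The left side is a mean of \<open>F\<close> over the rising flank minus
    one over the falling flank; in the limit this is \<open>F 0 - F t\<close>.\<close>
  have eq: "(\<integral>x. F x * (\<psi> ((x - e n) / e n) / e n) \<partial>lborel)
      - (\<integral>x. F x * (\<psi> ((x - (t - 2 * e n)) / e n) / e n) \<partial>lborel)
      = - (\<integral>x. indicator {0<..<b} x * (g1 x * \<phi> n x) \<partial>lborel)" for n
  proof -
    have "(LINT x|lebesgue_on {0<..<b}. f x * deriv (\<phi> n) x)
        = (\<integral>x. indicator {0<..<b} x * (F x * deriv (\<phi> n) x) \<partial>lborel)"
      by (rule integral_lebesgue_on_borel) (simp, simp add: F_def clamp_fun_eq, measurable)
    also have "\<dots> = (\<integral>x. F x * (\<psi> ((x - e n) / e n) / e n)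
        - F x * (\<psi> ((x - (t - 2 * e n)) / e n) / e n) \<partial>lborel)"
    proof (rule Bochner_Integration.integral_cong)
      show "indicator {0<..<b} x * (F x * deriv (\<phi> n) x) = F x * (\<psi> ((x - e n) / e n) / e n)
        - F x * (\<psi> ((x - (t - 2 * e n)) / e n) / e n)" for x
      proof -
        have "indicator {0<..<b} x * (F x * deriv (\<phi> n) x) = F x * deriv (\<phi> n) x"
          using d\<phi>0[of x n] by (cases "x \<in> {0<..<b}") simp_all
        then show ?thesis by (simp add: d\<phi> right_diff_distrib)
      qed
    qed simp
    also have "\<dots> = (\<integral>x. F x * (\<psi> ((x - e n) / e n) / e n) \<partial>lborel)
      - (\<integral>x. F x * (\<psi> ((x - (t - 2 * e n)) / e n) / e n) \<partial>lborel)"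
      by (rule Bochner_Integration.integral_diff[OF iF iF])
    finally show ?thesis
      using g test[of n] gg1[OF m1[of n]] by (simp add: L2_weak_derivative_def)
  qed
  have lim1: "(\<lambda>n. (\<integral>x. F x * (\<psi> ((x - e n) / e n) / e n) \<partial>lborel)
      - (\<integral>x. F x * (\<psi> ((x - (t - 2 * e n)) / e n) / e n) \<partial>lborel))
      \<longlonglongrightarrow> F 0 * (\<integral>y. \<psi> y \<partial>lborel) - F t * (\<integral>y. \<psi> y \<partial>lborel)"
  proof (intro tendsto_diff mollify_tendsto[OF F FC i\<psi>] elim e)
    show "(\<lambda>n. t - 2 * e n) \<longlonglongrightarrow> t"
      using tendsto_diff[OF tendsto_const tendsto_mult[OF tendsto_const elim], of t 2] by simp
  qed
  have lim2: "(\<lambda>n. \<integral>x. indicator {0<..<b} x * (g1 x * \<phi> n x) \<partial>lborel) \<longlonglongrightarrow> prim g1 t"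
    unfolding prim_def
  proof (rule integral_dominated_convergence)
    show "integrable lborel (\<lambda>x. \<bar>g1 x\<bar>)"
      using g1 by simp
    show "AE x in lborel. norm (indicator {0<..<b} x * (g1 x * \<phi> n x)) \<le> \<bar>g1 x\<bar>" for n
      using \<phi>_bound[of n] by (intro AE_I2) (auto simp: indicator_def abs_mult mult_left_le)
    \<comment> \<open>For each \<open>x\<close> inside \<open>{0<..<t}\<close> the value
      \<open>\<phi> n x\<close> is eventually \<open>1\<close>; the endpoints are a null
      set.\<close>
    show "AE x in lborel. (\<lambda>n. indicator {0<..<b} x * (g1 x * \<phi> n x)) \<longlonglongrightarrow> indicator {0..t} x * g1 x"
      using AE_lborel_singleton[of 0] AE_lborel_singleton[of t]
    proof eventually_elim
      case (elim x)
      consider "x < 0" | "x > t" | "0 < x" "x < t" using elim by linarith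
      then show ?case
      proof cases
        case 1
        then show ?thesis by (auto simp: indicator_def)
      next
        case 2
        then have "\<phi> n x = 0" for n using e[of n] by (intro \<phi>_right) auto
        then show ?thesis using 2 by (auto simp: indicator_def)
      next
        case 3
        have "(\<lambda>n. 2 * e n) \<longlonglongrightarrow> 2 * 0"
          by (intro tendsto_intros \<open>e \<longlonglongrightarrow> 0\<close>)
        then have "\<forall>\<^sub>F n in sequentially. 2 * e n < min x (t - x)"
          using 3 by (intro order_tendstoD(2)) auto
        then have "\<forall>\<^sub>F n in sequentially. \<phi> n x = 1"
          by eventually_elim (auto intro: \<phi>_mid)
        then have "\<forall>\<^sub>F n in sequentially. indicator {0<..<b} x * (g1 x * \<phi> n x) = indicator {0..t} x * g1 x"
          by eventually_elim (use 3 t0 in \<open>auto simp: indicator_def\<close>)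
        then show ?thesis by (rule tendsto_eventually)
      qed
    qed
  qed measurable
  have "F 0 - F t = - prim g1 t"
    using LIMSEQ_unique[OF lim1[unfolded eq \<psi>1] tendsto_minus[OF lim2]] by simp
  then show ?thesis
    using b t by (simp add: F_def clamp_fun_eq)
qed

section \<open>The fractional derivatives\<close>

lemma absolutely_continuous_fun_imp_continuous_on:
  assumes "absolutely_continuous_fun a b f"
  shows "continuous_on {a..b} f"
  unfolding continuous_on_iff
proof (intro ballI allI impI)
  fix x \<epsilon> :: real
  assume x: "x \<in> {a..b}" and "0 < \<epsilon>"
  then obtain \<delta> where "\<delta> > 0" and \<delta>: "\<forall>(n::nat) u v.
        (\<forall>i<n. a \<le> u i \<and> u i \<le> v i \<and> v i \<le> b) \<and>
        (\<forall>i<n. \<forall>j<n. i \<noteq> j \<longrightarrow> {u i<..<v i} \<inter> {u j<..<v j} = {}) \<and>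
        (\<Sum>i<n. v i - u i) < \<delta> \<longrightarrow> (\<Sum>i<n. \<bar>f (v i) - f (u i)\<bar>) < \<epsilon>"
    using assms[unfolded absolutely_continuous_fun_def, THEN spec, of \<epsilon>] by (elim impE exE conjE) auto
  \<comment> \<open>Continuity is the case of a single interval, \<open>n = 1\<close>.\<close>
  have *: "\<bar>f v - f u\<bar> < \<epsilon>" if "a \<le> u" "u \<le> v" "v \<le> b" "v - u < \<delta>" for u v
    using \<delta>[THEN spec, of 1, THEN spec, of "\<lambda>_. u", THEN spec, of "\<lambda>_. v"] that by simp
  have "dist (f y) (f x) < \<epsilon>" if "y \<in> {a..b}" "dist y x < \<delta>" for y
    using *[of x y] *[of y x] that x by (cases "x \<le> y") (auto simp: dist_real_def)
  then show "\<exists>d>0. \<forall>y\<in>{a..b}. dist y x < d \<longrightarrow> dist (f y) (f x) < \<epsilon>"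
    using \<open>\<delta> > 0\<close> by blast
qed

lemma H1_continuous_on: "f \<in> H1 b \<Longrightarrow> continuous_on {0..b} f"
  by (auto simp: H1_def intro: absolutely_continuous_fun_imp_continuous_on)

lemma max_norm_continuous:
  assumes "b \<ge> 0" "continuous_on {0..b} g"
  obtains t where "t \<in> {0..b}" "max_norm b g = \<bar>g t\<bar>" "\<And>s. s \<in> {0..b} \<Longrightarrow> \<bar>g s\<bar> \<le> \<bar>g t\<bar>"
proof -
  have "continuous_on {0..b} (\<lambda>t. \<bar>g t\<bar>)"
    using assms(2) by (intro continuous_intros)
  then obtain t where t: "t \<in> {0..b}" "\<forall>s\<in>{0..b}. \<bar>g s\<bar> \<le> \<bar>g t\<bar>"
    using continuous_attains_sup[of "{0..b}" "\<lambda>t. \<bar>g t\<bar>"] assms(1) by auto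
  then have "max_norm b g = \<bar>g t\<bar>"
    unfolding max_norm_def by (intro Greatest_equality) auto
  then show thesis using t that by blast
qed

text \<open>
  \<open>k\<close> is the derivative of the Mittag-Leffler kernel, which has an integrable singularity at \<open>0\<close>.
\<close>

locale abc_kernel =
  fixes b \<alpha> :: real and k :: "real \<Rightarrow> real"
  assumes b_pos: "b > 0"
    and k_integrable: "integrable lborel k"
    and kernel_eq: "\<And>s. 0 \<le> s \<Longrightarrow> s \<le> b \<Longrightarrow>
      mittag_leffler \<alpha> (- \<alpha> * (s powr \<alpha> / (1 - \<alpha>))) = 1 + prim k s"
begin

lemma k_measurable [measurable]: "k \<in> borel_measurable borel"
  using borel_measurable_integrable[OF k_integrable] by simp

definition kernel_mass :: real where
  "kernel_mass = (\<integral>u. \<bar>k u\<bar> \<partial>lborel)"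

lemma kernel_mass_nonneg: "kernel_mass \<ge> 0"
  by (simp add: kernel_mass_def)

lemma continuous_on_conv_k:
  assumes "continuous_on {0..b} f"
  shows "continuous_on {0..b} (conv k f)"
proof -
  have "continuous_on {0..b} (conv k (clamp_fun b f))"
    using assms b_pos by (intro continuous_on_conv k_integrable continuous_on_clamp_fun) auto
  then show ?thesis
    by (rule continuous_on_cong[THEN iffD1, rotated -1])
      (auto intro!: conv_cong simp: clamp_fun_eq)
qed

text \<open>Young's inequality for an L1 and a bounded factor, applied to \<open>f - h\<close>.
  Clamping supplies the global measurability behind \<open>conv_diff\<close> and
  \<open>abs_conv_le\<close>.\<close>

lemma conv_k_diff_bound:
  assumes f: "continuous_on {0..b} f" and h: "continuous_on {0..b} h"
    and D: "\<And>x. x \<in> {0..b} \<Longrightarrow> \<bar>f x - h x\<bar> \<le> D" and t: "t \<in> {0..b}"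
  shows "\<bar>conv k f t - conv k h t\<bar> \<le> D * kernel_mass"
proof -
  have D0: "D \<ge> 0" using D[of 0] b_pos by (simp add: order_trans[OF abs_ge_zero])
  let ?f = "clamp_fun b f" and ?h = "clamp_fun b h"
  have c: "continuous_on UNIV ?f" "continuous_on UNIV ?h"
    using f h b_pos by (auto intro: continuous_on_clamp_fun)
  have "compact (f ` {0..b})" "compact (h ` {0..b})"
    by (intro compact_continuous_image f h; simp)+
  then obtain C1 C2 where "\<And>x. x \<in> {0..b} \<Longrightarrow> \<bar>f x\<bar> \<le> C1" "\<And>x. x \<in> {0..b} \<Longrightarrow> \<bar>h x\<bar> \<le> C2"
    using compact_imp_bounded by (fastforce simp: bounded_iff)
  then have C: "\<bar>?f x\<bar> \<le> C1" "\<bar>?h x\<bar> \<le> C2" for x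
    using b_pos by (auto simp: clamp_fun_def)
  have "conv k f t - conv k h t = conv k ?f t - conv k ?h t"
    using t conv_cong[of t ?f f k] conv_cong[of t ?h h k] by (simp add: clamp_fun_eq)
  also have "\<dots> = conv k (\<lambda>x. ?f x - ?h x) t"
    using c C by (intro conv_diff[symmetric, OF k_integrable]) (auto intro: borel_measurable_continuous_onI)
  also have "\<bar>\<dots>\<bar> \<le> D * (\<integral>u. \<bar>k u\<bar> \<partial>lborel)"
    using c D D0 t
    by (intro abs_conv_le k_integrable)
      (auto intro!: borel_measurable_continuous_onI continuous_on_diff simp: clamp_fun_eq)
  finally show ?thesis by (simp add: kernel_mass_def)
qed

text \<open>Here the weak derivative disappears. Its primitive is \<open>f - f 0\<close> rather than
  \<open>f\<close>, and collecting the terms with \<open>f 0\<close> gives the boundary term,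
  \<open>f 0\<close> times the kernel at \<open>t\<close>.\<close>

lemma ABC_deriv_eq:
  assumes f: "f \<in> H1 b" and t: "t \<in> {0..b}"
  shows "ABC_deriv B b \<alpha> f t = B \<alpha> / (1 - \<alpha>) * (f t - f 0 * (1 + prim k t) + conv k f t)"
proof -
  define g where "g = weak_deriv b f"
  have g: "L2_weak_derivative b f g"
    \<comment> \<open>Membership in \<open>H1\<close> makes the \<open>SOME\<close> in
      \<open>weak_deriv\<close> meaningful. Which weak derivative is chosen does not matter, since
      each has \<open>f - f 0\<close> as its primitive.\<close>
    using f unfolding H1_def g_def weak_deriv_def by (auto intro: someI_ex[of "L2_weak_derivative b f"])
  have cf: "continuous_on {0..b} f"
    using f by (rule H1_continuous_on)
  have "square_integrable b g"
    using g by (simp add: L2_weak_derivative_def)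
  then obtain g1 where g1: "integrable lborel g1"
    and gg1: "\<And>S h. S \<in> sets borel \<Longrightarrow> S \<subseteq> {0..b} \<Longrightarrow> h \<in> borel_measurable borel \<Longrightarrow>
      (LINT x|lebesgue_on S. g x * h x) = (\<integral>x. indicator S x * (g1 x * h x) \<partial>lborel)"
    using square_integrable_borel_version by blast
  have prim_g1: "prim g1 s = f s - f 0" if "s \<in> {0..b}" for s
    using L2_weak_derivative_primitive[OF b_pos cf g g1 gg1 that] by fastforce
  have "(LINT x|lebesgue_on {0..t}. g x * mittag_leffler \<alpha> (- \<alpha> * ((t - x) powr \<alpha> / (1 - \<alpha>))))
      = (LINT x|lebesgue_on {0..t}. g x * (1 + prim k (t - x)))"
    using t by (intro Bochner_Integration.integral_cong) (auto simp: kernel_eq[symmetric])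
  also have "\<dots> = conv g1 (\<lambda>y. 1 + prim k y) t"
    unfolding conv_def using t by (intro gg1) auto
  also have "\<dots> = prim g1 t + conv k (prim g1) t"
    by (rule conv_one_plus_prim[OF g1 k_integrable])
  also have "conv k (prim g1) t = conv k (\<lambda>x. f x - f 0) t"
    using t by (intro conv_cong prim_g1) auto
  also have "\<dots> = conv k (\<lambda>x. clamp_fun b f x - f 0) t"
    using t by (intro conv_cong) (auto simp: clamp_fun_eq)
  also have "\<dots> = conv k (clamp_fun b f) t - conv k (\<lambda>_. f 0) t"
  proof -
    have "compact (f ` {0..b})"
      by (intro compact_continuous_image cf) simp
    then obtain C where "\<And>x. x \<in> {0..b} \<Longrightarrow> \<bar>f x\<bar> \<le> C"
      using compact_imp_bounded by (fastforce simp: bounded_iff)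
    then have "\<bar>clamp_fun b f x\<bar> \<le> C" for x
      using b_pos by (simp add: clamp_fun_def)
    then show ?thesis
      using continuous_on_clamp_fun[OF _ cf] b_pos
      by (intro conv_diff[OF k_integrable, of _ _ C _ "\<bar>f 0\<bar>"]) (auto intro: borel_measurable_continuous_onI)
  qed
  also have "conv k (clamp_fun b f) t = conv k f t"
    using t by (intro conv_cong) (auto simp: clamp_fun_eq)
  also have "conv k (\<lambda>_. f 0) t = f 0 * prim k t"
    unfolding conv_def prim_def by (simp add: mult_ac flip: integral_mult_right_zero)
  finally have "(LINT x|lebesgue_on {0..t}. g x * mittag_leffler \<alpha> (- \<alpha> * ((t - x) powr \<alpha> / (1 - \<alpha>))))
      = f t - f 0 * (1 + prim k t) + conv k f t"
    using t by (simp add: prim_g1 algebra_simps)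
  then show ?thesis
    unfolding ABC_deriv_def g_def by (simp only:)
qed

text \<open>Instead of differentiating under the integral across the singularity of
  \<open>k\<close>, the integral is rewritten as the primitive of a continuous function. The
  fundamental theorem then yields existence and value of the derivative together.\<close>

lemma ABR_deriv_eq:
  assumes f: "continuous_on {0..b} f" and t: "t \<in> {0..b}"
  shows "ABR_deriv B b \<alpha> f t = B \<alpha> / (1 - \<alpha>) * (f t + conv k f t)"
proof -
  let ?F = "clamp_fun b f"
  have cF: "continuous_on UNIV ?F"
    using f b_pos by (intro continuous_on_clamp_fun) auto
  have [measurable]: "?F \<in> borel_measurable borel"
    using cF by (rule borel_measurable_continuous_onI)
  \<comment> \<open>\<open>conv_one_plus_prim\<close> asks for a function integrable on the line,
    which the constant tails of \<open>?F\<close> can prevent.\<close>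
  define q where "q x = indicator {0..b} x * ?F x" for x
  have q: "integrable lborel q"
    using borel_integrable_compact[of "{0..b}" ?F] continuous_on_subset[OF cF]
    by (auto simp: q_def[abs_def])
  have cont: "continuous_on {0..b} (\<lambda>s. f s + conv k ?F s)"
    by (intro continuous_on_add f continuous_on_conv k_integrable cF)
  have "(LINT x|lebesgue_on {0..s}. f x * mittag_leffler \<alpha> (- \<alpha> * ((s - x) powr \<alpha> / (1 - \<alpha>))))
      = integral {0..s} (\<lambda>s. f s + conv k ?F s)" if s: "s \<in> {0..b}" for s
  proof -
    have "(LINT x|lebesgue_on {0..s}. f x * mittag_leffler \<alpha> (- \<alpha> * ((s - x) powr \<alpha> / (1 - \<alpha>))))
      = (\<integral>x. indicator {0..s} x * (?F x * (1 + prim k (s - x))) \<partial>lborel)"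
      using s by (intro integral_lebesgue_on_borel) (simp_all add: kernel_eq[symmetric] clamp_fun_eq)
    also have "\<dots> = conv q (\<lambda>y. 1 + prim k y) s"
      unfolding conv_def q_def using s
      by (intro Bochner_Integration.integral_cong) (auto simp: indicator_def)
    also have "\<dots> = prim q s + conv k (prim q) s"
      by (rule conv_one_plus_prim[OF q k_integrable])
    also have "prim q s = prim f s"
      using s by (intro prim_cong) (auto simp: q_def clamp_fun_eq)
    also have "conv k (prim q) s = conv k (prim ?F) s"
      using s by (intro conv_cong prim_cong) (auto simp: q_def)
    also have "\<dots> = prim (conv k ?F) s"
      by (rule prim_conv[OF k_integrable cF, symmetric])
    also have "prim f s = integral {0..s} f"
      using s by (intro prim_eq_integral[OF f]) auto
    also have "prim (conv k ?F) s = integral {0..s} (conv k ?F)"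
      using s by (intro prim_eq_integral[OF continuous_on_conv[OF k_integrable cF]]) auto
    also have "integral {0..s} f + integral {0..s} (conv k ?F) = integral {0..s} (\<lambda>s. f s + conv k ?F s)"
      using s
      by (intro Henstock_Kurzweil_Integration.integral_add[symmetric] integrable_continuous_real
          continuous_on_conv k_integrable cF continuous_on_subset[OF f]) auto
    finally show ?thesis .
  qed
  then have "((\<lambda>s. LINT x|lebesgue_on {0..s}. f x * mittag_leffler \<alpha> (- \<alpha> * ((s - x) powr \<alpha> / (1 - \<alpha>))))
      has_vector_derivative f t + conv k ?F t) (at t within {0..b})"
    by (intro has_vector_derivative_transform[OF t _ integral_has_vector_derivative[OF cont t]])
  \<comment> \<open>Since \<open>b > 0\<close>, derivatives within \<open>{0..b}\<close> are unique,
    also one-sidedly at \<open>0\<close> and \<open>b\<close>, so \<open>vector_derivative\<close>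
    picks this value.\<close>
  then have "vector_derivative (\<lambda>s. LINT x|lebesgue_on {0..s}. f x * mittag_leffler \<alpha> (- \<alpha> * ((s - x) powr \<alpha> / (1 - \<alpha>))))
      (at t within {0..b}) = f t + conv k ?F t"
    using b_pos t by (intro vector_derivative_within_closed_interval)
  moreover have "conv k ?F t = conv k f t"
    using t by (intro conv_cong) (auto simp: clamp_fun_eq)
  ultimately show ?thesis
    by (simp add: ABR_deriv_def)
qed

text \<open>Reduces the norm inequality to a pointwise one. The premise ranges over all bounds
  \<open>D\<close>, so estimates need not mention \<open>max_norm\<close>; it is then used with the
  attained maximum of \<open>\<bar>f - h\<bar>\<close>.\<close>

lemma max_norm_diff_le:
  assumes f: "continuous_on {0..b} f" and h: "continuous_on {0..b} h"
    and \<Phi>: "continuous_on {0..b} \<Phi>"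
    and le: "\<And>t D. t \<in> {0..b} \<Longrightarrow> (\<And>x. x \<in> {0..b} \<Longrightarrow> \<bar>f x - h x\<bar> \<le> D) \<Longrightarrow> \<bar>\<Phi> t\<bar> \<le> H * D"
  shows "max_norm b \<Phi> \<le> H * max_norm b (\<lambda>t. f t - h t)"
proof -
  obtain t where "t \<in> {0..b}" "max_norm b \<Phi> = \<bar>\<Phi> t\<bar>"
    using max_norm_continuous[OF _ \<Phi>] b_pos by (metis less_imp_le)
  moreover obtain s where "max_norm b (\<lambda>t. f t - h t) = \<bar>f s - h s\<bar>"
    "\<And>x. x \<in> {0..b} \<Longrightarrow> \<bar>f x - h x\<bar> \<le> \<bar>f s - h s\<bar>"
    using max_norm_continuous[OF _ continuous_on_diff[OF f h]] b_pos by (metis less_imp_le)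
  ultimately show ?thesis
    using le by metis
qed

lemma ABR_deriv_lipschitz:
  assumes f: "f \<in> H1 b" and h: "h \<in> H1 b"
  shows "max_norm b (\<lambda>t. ABR_deriv B b \<alpha> f t - ABR_deriv B b \<alpha> h t)
    \<le> \<bar>B \<alpha> / (1 - \<alpha>)\<bar> * (2 + 2 * kernel_mass) * max_norm b (\<lambda>t. f t - h t)"
proof (rule max_norm_diff_le)
  let ?c = "B \<alpha> / (1 - \<alpha>)"
  show cf: "continuous_on {0..b} f" and ch: "continuous_on {0..b} h"
    using f h by (auto intro: H1_continuous_on)
  have eq: "ABR_deriv B b \<alpha> f t - ABR_deriv B b \<alpha> h t
      = ?c * ((f t - h t) + (conv k f t - conv k h t))" if "t \<in> {0..b}" for t
    by (simp add: ABR_deriv_eq[OF cf that] ABR_deriv_eq[OF ch that] algebra_simps)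
  have "continuous_on {0..b} (\<lambda>t. ?c * ((f t - h t) + (conv k f t - conv k h t)))"
    by (intro continuous_intros cf ch continuous_on_conv_k)
  then show "continuous_on {0..b} (\<lambda>t. ABR_deriv B b \<alpha> f t - ABR_deriv B b \<alpha> h t)"
    by (rule continuous_on_cong[THEN iffD1, rotated -1]) (simp_all add: eq)
  fix t D
  assume t: "t \<in> {0..b}" and D: "\<And>x. x \<in> {0..b} \<Longrightarrow> \<bar>f x - h x\<bar> \<le> D"
  \<comment> \<open>The direct estimate is \<open>(1 + kernel_mass) * D\<close>. Nonnegativity
    allows doubling it, so that one constant serves ABR and ABC.\<close>
  have "0 \<le> D * kernel_mass" "0 \<le> D"
    using D[OF t] kernel_mass_nonneg by auto
  then have "\<bar>(f t - h t) + (conv k f t - conv k h t)\<bar> \<le> (2 + 2 * kernel_mass) * D"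
    using D[OF t] conv_k_diff_bound[OF cf ch D t] by (simp add: algebra_simps)
  then show "\<bar>ABR_deriv B b \<alpha> f t - ABR_deriv B b \<alpha> h t\<bar> \<le> \<bar>?c\<bar> * (2 + 2 * kernel_mass) * D"
    unfolding eq[OF t] by (simp only: abs_mult mult.assoc) (intro mult_left_mono, auto)
qed

lemma ABC_deriv_lipschitz:
  assumes f: "f \<in> H1 b" and h: "h \<in> H1 b"
  shows "max_norm b (\<lambda>t. ABC_deriv B b \<alpha> f t - ABC_deriv B b \<alpha> h t)
    \<le> \<bar>B \<alpha> / (1 - \<alpha>)\<bar> * (2 + 2 * kernel_mass) * max_norm b (\<lambda>t. f t - h t)"
proof (rule max_norm_diff_le)
  let ?c = "B \<alpha> / (1 - \<alpha>)"
  show cf: "continuous_on {0..b} f" and ch: "continuous_on {0..b} h"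
    using f h by (auto intro: H1_continuous_on)
  have eq: "ABC_deriv B b \<alpha> f t - ABC_deriv B b \<alpha> h t
      = ?c * ((f t - h t) - (f 0 - h 0) * (1 + prim k t) + (conv k f t - conv k h t))"
    if "t \<in> {0..b}" for t
    by (simp add: ABC_deriv_eq[OF f that] ABC_deriv_eq[OF h that] algebra_simps)
  have "continuous_on {0..b}
      (\<lambda>t. ?c * ((f t - h t) - (f 0 - h 0) * (1 + prim k t) + (conv k f t - conv k h t)))"
    by (intro continuous_intros cf ch continuous_on_conv_k continuous_on_prim k_integrable)
  then show "continuous_on {0..b} (\<lambda>t. ABC_deriv B b \<alpha> f t - ABC_deriv B b \<alpha> h t)"
    by (rule continuous_on_cong[THEN iffD1, rotated -1]) (simp_all add: eq)
  fix t D
  assume t: "t \<in> {0..b}" and D: "\<And>x. x \<in> {0..b} \<Longrightarrow> \<bar>f x - h x\<bar> \<le> D"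
  \<comment> \<open>The boundary term costs \<open>D * (1 + kernel_mass)\<close>, as much as the
    other two terms together; hence the factor \<open>2\<close> in the constant.\<close>
  have "\<bar>(f 0 - h 0) * (1 + prim k t)\<bar> \<le> D * (1 + kernel_mass)"
    unfolding abs_mult using D[of 0] b_pos abs_prim_le[OF k_integrable, of t]
    by (intro mult_mono) (auto simp: kernel_mass_def)
  then have "\<bar>(f t - h t) - (f 0 - h 0) * (1 + prim k t) + (conv k f t - conv k h t)\<bar> \<le> (2 + 2 * kernel_mass) * D"
    using D[OF t] conv_k_diff_bound[OF cf ch D t] by (simp add: algebra_simps)
  then show "\<bar>ABC_deriv B b \<alpha> f t - ABC_deriv B b \<alpha> h t\<bar> \<le> \<bar>?c\<bar> * (2 + 2 * kernel_mass) * D"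
    unfolding eq[OF t] by (simp only: abs_mult mult.assoc) (intro mult_left_mono, auto)
qed

end

theorem theorem3:
  fixes B :: "real \<Rightarrow> real" and b \<alpha> :: real
  assumes "B 0 = 1" and "B 1 = 1" and "b > 0" and "0 \<le> \<alpha>" and "\<alpha> < 1"
  shows "\<exists>H\<ge>0. \<forall>f\<in>H1 b. \<forall>h\<in>H1 b.
     max_norm b (\<lambda>t. ABR_deriv B b \<alpha> f t - ABR_deriv B b \<alpha> h t) \<le> H * max_norm b (\<lambda>t. f t - h t) \<and>
     max_norm b (\<lambda>t. ABC_deriv B b \<alpha> f t - ABC_deriv B b \<alpha> h t) \<le> H * max_norm b (\<lambda>t. f t - h t)"
proof -
  \<comment> \<open>\<open>k\<close> is fixed by \<open>b\<close> and \<alpha> before any functions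
    are chosen, which makes the constant uniform in \<open>f\<close> and \<open>h\<close>.\<close>
  obtain k where "abc_kernel b \<alpha> k"
    using mittag_leffler_kernel_primitive[OF assms(4,5,3)] assms(3)
    by (metis abc_kernel.intro)
  then interpret abc_kernel b \<alpha> k .
  show ?thesis
    using ABR_deriv_lipschitz ABC_deriv_lipschitz kernel_mass_nonneg
    by (intro exI[of _ "\<bar>B \<alpha> / (1 - \<alpha>)\<bar> * (2 + 2 * kernel_mass)"]) auto
qed

end
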